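(* Let $\Omega$ be a $\sigma$-algebra of subsets of a set $X$, $E$ a Banach lattice, and $P\colon\Omega\to\mathcal L_{\mathrm r}(E)$ a positive spectral measure. (1) The map $\pi_P\colon\mathcal S(X)\to(\mathcal L_{\mathrm r}(E),\|\cdot\|)$, defined on the simple functions by $\pi_P\bigl(\sum_{i=1}^n\alpha_i\chi_{\Delta_i}\bigr)=\sum_{i=1}^n\alpha_iP(\Delta_i)$, extends uniquely to a bounded linear map $\pi_P\colon\mathcal B(X)\to(\mathcal L(E),\|\cdot\|)$. This extension is a positive representation $\pi_P\colon\mathcal B(X)\to(\mathcal L_{\mathrm r}(E),\|\cdot\|)$ with norm $\|\pi_P\|=\|P(X)\|=\|\pi_P(\mathbf 1_X)\|$. (2) $\pi_P$ is unital if and only if $P$ is unital. (3) For $\phi\in\mathcal B(X)$, $\pi_P(\phi)\in\mathcal L_{\mathrm r}(E)$ is the unique element of $\mathcal L(E)$ such that $\langle\pi_P(\phi)x,x'\rangle=\int_X\phi\,d\mu_{x,x'}$ for all $x\in E$, $x'\in E'$. (4) If $\phi\in\mathcal B(X)$ and $(\phi_n)_{n=1}^\infty$ is a bounded sequence in $\mathcal B(X)$ such that $\lim_{n\to\infty}\phi_n(\xi)=\phi(\xi)$ for all $\xi\in X$, then $\pi_P(\phi)=\mathrm{WOT\text{-}}\lim_n\pi_P(\phi_n)$. (5) The closed subalgebras of $(\mathcal L(E),\|\cdot\|)$ generated by $P(\Omega)$, $\pi_P(\mathcal S(X))$, and $\pi_P(\mathcal B(X))$ are equal. (6) The commutants of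 $P(\Omega)$, $\pi_P(\mathcal S(X))$, and $\pi_P(\mathcal B(X))$ in $\mathcal L(E)$ are equal. (7) If $E$ is Dedekind complete, then: (a) $\pi_P\colon\mathcal B(X)\to(\mathcal L_{\mathrm r}(E),\|\cdot\|_{\mathrm r})$ is bounded, with norm $\|\pi_P\|_{\mathrm r}=\|P(X)\|=\|\pi_P(\mathbf 1_X)\|$. (b) The closed subalgebras of $(\mathcal L_{\mathrm r}(E),\|\cdot\|_{\mathrm r})$ generated by $P(\Omega)$, $\pi_P(\mathcal S(X))$, and $\pi_P(\mathcal B(X))$ are equal, and this common subalgebra is contained in the common subalgebra in part (5).
   Context: All vector spaces are real. $\mathcal B(X)$ is the Banach lattice algebra of bounded $\Omega$-measurable real-valued functions on $X$ (supremum norm, pointwise operations), $\mathcal S(X)$ its subalgebra of simple functions, $\mathbf 1_X$ the constant function $1$, and $\chi_\Delta$ the characteristic function of $\Delta$. For a Banach lattice $E$ with norm dual $E'$, $\mathcal L(E)$ denotes the bounded linear operators on $E$ with operator norm $\|\cdot\|$, and $\mathcal L_{\mathrm r}(E)\subset\mathcal L(E)$ the regular operators (differences of two positive linear operators). If $E$ is Dedekind complete, $\|T\|_{\mathrm r}=\||T|\|$ is the regular norm on $\mathcal L_{\mathrm r}(E)$. For a linear map into $\mathcal L_{\mathrm r}(E)$, $\|\pi\|$ and $\|\pi\|_{\mathrm r}$ denote its norm when the codomain carries $\|\cdot\|$, resp. $\|\cdot\|_{\mathrm r}$. $\mathrm{WOT\text{-}}\lim$ is the limit in the weak operator topology of $\mathcal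 L(E)$. A positive representation of an ordered algebra $A$ on $E$ is an algebra homomorphism $\pi\colon A\to\mathcal L(E)$ with $\pi(a)$ a positive operator for every $a\geq0$; it need not be unital. A positive spectral measure on $\Omega$ is a map $P\colon\Omega\to\mathcal L_{\mathrm r}(E)$ such that: each $P(\Delta)$ is a positive projection; $P(\emptyset)=0$; $P(\Delta_1\cap\Delta_2)=P(\Delta_1)P(\Delta_2)$ for all $\Delta_1,\Delta_2\in\Omega$; and for pairwise disjoint $\Delta_n\in\Omega$ ($n\geq1$) and $x\in E$ one has $P(\bigcup_n\Delta_n)x=\sum_nP(\Delta_n)x$ with norm convergence. $P$ is unital if $P(X)$ is the identity on $E$. For $x\in E$, $x'\in E'$, $\mu_{x,x'}$ is the finite signed measure $\mu_{x,x'}(\Delta)=\langle P(\Delta)x,x'\rangle$ on $\Omega$. *)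

theory Defs
  imports "HOL-Analysis.Analysis" "HOL-Library.Lattice_Algebras"
begin

section \<open>Banach lattices and their operators\<close>

class banach_lattice = banach + ordered_real_vector + lattice_ab_group_add_abs +
  assumes norm_mono_abs: "\<bar>x\<bar> \<le> \<bar>y\<bar> \<Longrightarrow> norm x \<le> norm y"

text \<open>Only nonempty sets that are bounded above are required to have a supremum.\<close>

definition dedekind_complete :: "'e::order itself \<Rightarrow> bool" where
  "dedekind_complete _ \<longleftrightarrow>
     (\<forall>A :: 'e set. A \<noteq> {} \<and> bdd_above A \<longrightarrow>
        (\<exists>s. (\<forall>a\<in>A. a \<le> s) \<and> (\<forall>u. (\<forall>a\<in>A. a \<le> u) \<longrightarrow> s \<le> u)))"

definition positive_linear :: "('e::banach_lattice \<Rightarrow> 'e) \<Rightarrow> bool" where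
  "positive_linear f \<longleftrightarrow> linear f \<and> (\<forall>x. 0 \<le> x \<longrightarrow> 0 \<le> f x)"

definition positive_op :: "('e::banach_lattice \<Rightarrow>\<^sub>L 'e) \<Rightarrow> bool" where
  "positive_op T \<longleftrightarrow> positive_linear (blinfun_apply T)"

text \<open>The two positive summands need not be assumed to be bounded: positive linear operators
  on a Banach lattice are automatically bounded.\<close>

definition regular_ops :: "('e::banach_lattice \<Rightarrow>\<^sub>L 'e) set" where
  "regular_ops = {T. \<exists>S R. positive_linear S \<and> positive_linear R \<and>
                       (\<forall>x. blinfun_apply T x = S x - R x)}"

text \<open>The modulus is the supremum of \<open>T\<close> and \<open>- T\<close> in the ordered vector space
  of regular operators. It (and hence the regular norm) is only meaningful for regular \<open>T\<close> on
  a Dedekind complete Banach lattice, where this supremum exists.\<close>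

definition modulus_op :: "('e::banach_lattice \<Rightarrow>\<^sub>L 'e) \<Rightarrow> ('e \<Rightarrow>\<^sub>L 'e)" where
  "modulus_op T = (THE S. S \<in> regular_ops \<and> positive_op (S - T) \<and> positive_op (S - (- T)) \<and>
     (\<forall>R\<in>regular_ops. positive_op (R - T) \<and> positive_op (R - (- T)) \<longrightarrow> positive_op (R - S)))"

definition regular_norm :: "('e::banach_lattice \<Rightarrow>\<^sub>L 'e) \<Rightarrow> real" where
  "regular_norm T = norm (modulus_op T)"

definition weak_operator_topology ::
    "('a::real_normed_vector \<Rightarrow>\<^sub>L 'b::real_normed_vector) topology" where
  "weak_operator_topology =
     pullback_topology UNIV
       (\<lambda>T. \<lambda>(x, x'). blinfun_apply x' (blinfun_apply T x) :: real) euclidean"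

definition commutant :: "('e::real_normed_vector \<Rightarrow>\<^sub>L 'e) set \<Rightarrow> ('e \<Rightarrow>\<^sub>L 'e) set" where
  "commutant A = {T. \<forall>S\<in>A. T o\<^sub>L S = S o\<^sub>L T}"

text \<open>Subalgebras need not contain the identity.\<close>

definition op_subalgebra :: "('e::real_normed_vector \<Rightarrow>\<^sub>L 'e) set \<Rightarrow> bool" where
  "op_subalgebra A \<longleftrightarrow> subspace A \<and> (\<forall>S\<in>A. \<forall>T\<in>A. S o\<^sub>L T \<in> A)"

definition closed_op_subalgebra :: "('e::real_normed_vector \<Rightarrow>\<^sub>L 'e) set \<Rightarrow> bool" where
  "closed_op_subalgebra A \<longleftrightarrow> op_subalgebra A \<and> closed A"

definition closed_regular_subalgebra :: "('e::banach_lattice \<Rightarrow>\<^sub>L 'e) set \<Rightarrow> bool" where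
  "closed_regular_subalgebra A \<longleftrightarrow>
     op_subalgebra A \<and> A \<subseteq> regular_ops \<and>
     (\<forall>T S. (\<forall>n::nat. T n \<in> A) \<and> S \<in> regular_ops \<and>
            (\<lambda>n. regular_norm (T n - S)) \<longlonglongrightarrow> 0 \<longrightarrow> S \<in> A)"


section \<open>Function algebras\<close>

text \<open>A function on \<open>X\<close> is represented by its extension by zero to the whole type. Thus the
  characteristic function of \<open>\<Delta> \<subseteq> X\<close> is \<^term>\<open>indicator \<Delta>\<close>, the constant one
  is \<^term>\<open>indicator X\<close>, pointwise order and operations can be taken on the whole type, and the
  supremum in \<open>sup_norm\<close> gives the expected value 0 also for empty \<open>X\<close>.\<close>

definition bounded_measurable :: "'a set \<Rightarrow> 'a set set \<Rightarrow> ('a \<Rightarrow> real) set" where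
  "bounded_measurable X \<Omega> =
     {f \<in> borel_measurable (sigma X \<Omega>). bounded (f ` X) \<and> (\<forall>\<xi>. \<xi> \<notin> X \<longrightarrow> f \<xi> = 0)}"

definition simple_functions :: "'a set \<Rightarrow> 'a set set \<Rightarrow> ('a \<Rightarrow> real) set" where
  "simple_functions X \<Omega> =
     {f. simple_function (sigma X \<Omega>) f \<and> (\<forall>\<xi>. \<xi> \<notin> X \<longrightarrow> f \<xi> = 0)}"

definition sup_norm :: "('a \<Rightarrow> real) \<Rightarrow> real" where
  "sup_norm f = (SUP \<xi>. \<bar>f \<xi>\<bar>)"

definition linear_on_functions ::
    "('a \<Rightarrow> real) set \<Rightarrow> (('a \<Rightarrow> real) \<Rightarrow> 'v::real_vector) \<Rightarrow> bool" where
  "linear_on_functions A \<pi> \<longleftrightarrow>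
     (\<forall>f\<in>A. \<forall>g\<in>A. \<pi> (\<lambda>\<xi>. f \<xi> + g \<xi>) = \<pi> f + \<pi> g) \<and>
     (\<forall>c. \<forall>f\<in>A. \<pi> (\<lambda>\<xi>. c * f \<xi>) = c *\<^sub>R \<pi> f)"

text \<open>Boundedness and norm of a map on \<open>A\<close>, where \<open>A\<close> carries the supremum norm and the
  codomain carries the norm \<open>N\<close>.\<close>

definition bounded_on_functions ::
    "('a \<Rightarrow> real) set \<Rightarrow> ('v \<Rightarrow> real) \<Rightarrow> (('a \<Rightarrow> real) \<Rightarrow> 'v) \<Rightarrow> bool" where
  "bounded_on_functions A N \<pi> \<longleftrightarrow> (\<exists>K. \<forall>f\<in>A. N (\<pi> f) \<le> K * sup_norm f)"

definition map_norm ::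
    "('a \<Rightarrow> real) set \<Rightarrow> ('v \<Rightarrow> real) \<Rightarrow> (('a \<Rightarrow> real) \<Rightarrow> 'v) \<Rightarrow> real" where
  "map_norm A N \<pi> = (SUP f\<in>{f\<in>A. sup_norm f \<le> 1}. N (\<pi> f))"

definition positive_representation ::
    "('a \<Rightarrow> real) set \<Rightarrow> (('a \<Rightarrow> real) \<Rightarrow> 'e::banach_lattice \<Rightarrow>\<^sub>L 'e) \<Rightarrow> bool" where
  "positive_representation A \<pi> \<longleftrightarrow>
     linear_on_functions A \<pi> \<and>
     (\<forall>f\<in>A. \<forall>g\<in>A. \<pi> (\<lambda>\<xi>. f \<xi> * g \<xi>) = \<pi> f o\<^sub>L \<pi> g) \<and>
     (\<forall>f\<in>A. (\<forall>\<xi>. 0 \<le> f \<xi>) \<longrightarrow> positive_op (\<pi> f))"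


section \<open>Spectral measures\<close>

definition positive_spectral_measure ::
    "'a set set \<Rightarrow> ('a set \<Rightarrow> 'e::banach_lattice \<Rightarrow>\<^sub>L 'e) \<Rightarrow> bool" where
  "positive_spectral_measure \<Omega> P \<longleftrightarrow>
     (\<forall>\<Delta>\<in>\<Omega>. P \<Delta> \<in> regular_ops \<and> positive_op (P \<Delta>) \<and> P \<Delta> o\<^sub>L P \<Delta> = P \<Delta>) \<and>
     P {} = 0 \<and>
     (\<forall>\<Delta>\<^sub>1\<in>\<Omega>. \<forall>\<Delta>\<^sub>2\<in>\<Omega>. P (\<Delta>\<^sub>1 \<inter> \<Delta>\<^sub>2) = P \<Delta>\<^sub>1 o\<^sub>L P \<Delta>\<^sub>2) \<and>
     (\<forall>\<Delta> x. range \<Delta> \<subseteq> \<Omega> \<and> disjoint_family \<Delta> \<longrightarrow>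
        (\<lambda>n::nat. blinfun_apply (P (\<Delta> n)) x) sums blinfun_apply (P (\<Union>n. \<Delta> n)) x)"

definition spectral_scalar_measure ::
    "('a set \<Rightarrow> 'e::real_normed_vector \<Rightarrow>\<^sub>L 'e) \<Rightarrow> 'e \<Rightarrow> ('e \<Rightarrow>\<^sub>L real) \<Rightarrow> 'a set \<Rightarrow> real" where
  "spectral_scalar_measure P x x' \<Delta> = blinfun_apply x' (blinfun_apply (P \<Delta>) x)"

text \<open>A finite signed measure is represented by its set function \<open>\<mu>\<close> on \<open>\<Omega>\<close>. Its Jordan
  decomposition consists of the positive variations of \<open>\<mu>\<close> and \<open>- \<mu>\<close>, and the integral
  with respect to \<open>\<mu>\<close> is the difference of the Lebesgue integrals with respect to these.\<close>

definition positive_variation :: "'a set \<Rightarrow> 'a set set \<Rightarrow> ('a set \<Rightarrow> real) \<Rightarrow> 'a measure" where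
  "positive_variation X \<Omega> \<mu> =
     measure_of X \<Omega> (\<lambda>\<Delta>. ennreal (SUP A\<in>{A\<in>\<Omega>. A \<subseteq> \<Delta>}. \<mu> A))"

definition signed_integral ::
    "'a set \<Rightarrow> 'a set set \<Rightarrow> ('a set \<Rightarrow> real) \<Rightarrow> ('a \<Rightarrow> real) \<Rightarrow> real" where
  "signed_integral X \<Omega> \<mu> f =
     integral\<^sup>L (positive_variation X \<Omega> \<mu>) f -
     integral\<^sup>L (positive_variation X \<Omega> (\<lambda>\<Delta>. - \<mu> \<Delta>)) f"

text \<open>The formula is required for every way of writing a simple function as a linear
  combination of characteristic functions, so it includes that \<open>\<pi>\<close> is well defined on simple
  functions. Only the values of \<open>\<pi>\<close> on \<open>bounded_measurable X \<Omega>\<close> are relevant.\<close>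

definition spectral_extension ::
    "'a set \<Rightarrow> 'a set set \<Rightarrow> ('a set \<Rightarrow> 'e::banach_lattice \<Rightarrow>\<^sub>L 'e) \<Rightarrow>
     (('a \<Rightarrow> real) \<Rightarrow> 'e \<Rightarrow>\<^sub>L 'e) \<Rightarrow> bool" where
  "spectral_extension X \<Omega> P \<pi> \<longleftrightarrow>
     linear_on_functions (bounded_measurable X \<Omega>) \<pi> \<and>
     bounded_on_functions (bounded_measurable X \<Omega>) norm \<pi> \<and>
     (\<forall>(n::nat) \<alpha> \<Delta>. (\<forall>i<n. \<Delta> i \<in> \<Omega>) \<longrightarrow>
        \<pi> (\<lambda>\<xi>. \<Sum>i<n. \<alpha> i * indicator (\<Delta> i) \<xi>) = (\<Sum>i<n. \<alpha> i *\<^sub>R P (\<Delta> i)))"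

end

theory Submission
  imports Defs
begin

text \<open>The operator \<open>\<pi> \<phi>\<close> is characterised weakly, by \<open>\<langle>T x, x'\<rangle> = \<integral>\<phi> d\<mu>\<^sub>x\<^sub>,\<^sub>x\<^sub>'\<close>. Uniqueness of such a \<open>T\<close>
  is the Hahn--Banach theorem, and it makes well-definedness and linearity on simple functions
  automatic. If \<open>\<bar>\<phi>\<bar> \<le> c\<close>, then positivity on simple functions gives \<open>- c P(X) \<le> T \<le> c P(X)\<close>, hence
  \<open>\<parallel>T\<parallel> \<le> c \<parallel>P(X)\<parallel>\<close>, and in the Dedekind complete case the same bound for the regular norm. So
  operators for uniform limits of simple functions exist as norm limits, and statements about
  all bounded measurable functions reduce to characteristic functions by linearity and
  uniform limits. Part (4) is dominated convergence for the Jordan decomposition of \<open>\<mu>\<^sub>x\<^sub>,\<^sub>x\<^sub>'\<close>.\<close>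

section \<open>Positive and regular operators\<close>

text \<open>The bound by \<open>P X\<close> has to be proved twice. For simple functions it must
  precede the operator of a general bounded measurable function, since it is what makes the
  approximating operators a Cauchy sequence. Once positivity has passed to norm limits it is proved
  again for all functions, now as an order interval, because the order form is what controls the
  regular norm as well. That norm is defined through a definite description of the modulus, so an
  estimate for an operator without a sign rests on the Riesz-Kantorovich construction. The weak
  formula says nothing immediate about products. Multiplicativity therefore starts from
  \<open>P (A \<inter> C) = P A o\<^sub>L P C\<close> and is extended one factor at a time.
  Generated subalgebras and commutants share one argument: each depends only on which closed
  subalgebras contain the generating set.\<close>

lemma norm_abs_eq [simp]: "norm \<bar>x\<bar> = norm (x::'e::banach_lattice)"
  by (intro order.antisym norm_mono_abs) simp_all

lemma nonneg_difference: "\<exists>a b. 0 \<le> a \<and> 0 \<le> b \<and> x = a - (b::'e::lattice_ab_group_add)"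
  by (metis diff_minus_eq_add neg_0_le_iff_le nprt_le_zero prts zero_le_pprt)

text \<open>Since \<open>0 \<le> f n\<close>, one has \<open>- x \<le> \<bar>f n - x\<bar>\<close>.
  So the negative part \<open>sup (- x) 0\<close> has norm at most \<open>norm (f n - x)\<close>,
  which tends to 0. This is closedness of the positive cone.\<close>

lemma nonneg_limit:
  fixes x :: "'e::banach_lattice"
  assumes f: "f \<longlonglongrightarrow> x" and nn: "\<And>n. 0 \<le> f n"
  shows "0 \<le> x"
proof -
  have "norm (sup (- x) 0) \<le> norm (f n - x)" for n
  proof (rule norm_mono_abs)
    have "- x \<le> \<bar>f n - x\<bar>"
      using nn[of n] by (smt (verit, best) abs_ge_self add_increasing diff_conv_add_uminus order.trans order_refl)
    then show "\<bar>sup (- x) 0\<bar> \<le> \<bar>f n - x\<bar>"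
      by (simp add: abs_of_nonneg)
  qed
  moreover have "(\<lambda>n. norm (f n - x)) \<longlonglongrightarrow> 0"
    using f by (simp add: LIM_zero_iff tendsto_norm_zero)
  ultimately have "norm (sup (- x) 0) \<le> 0"
    by (meson LIMSEQ_le_const)
  then have "sup (- x) 0 = 0" by simp
  then show ?thesis by (metis neg_le_0_iff_le sup.cobounded1)
qed

lemma positive_linear_mono: "positive_linear f \<Longrightarrow> x \<le> y \<Longrightarrow> f x \<le> f y"
  unfolding positive_linear_def by (metis diff_ge_0_iff_ge linear_diff)

text \<open>On the positive and on the negative part of \<open>x\<close> the hypotheses bound
  \<bar>f\<bar> by \<open>g\<close>, and the two values of \<open>g\<close> add up to
  \<open>g \<bar>x\<bar>\<close>.\<close>

lemma abs_le_if_dominated: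
  fixes f g :: "'e::banach_lattice \<Rightarrow> 'e"
  assumes "linear f" and "linear g"
    and le: "\<And>y. 0 \<le> y \<Longrightarrow> f y \<le> g y" "\<And>y. 0 \<le> y \<Longrightarrow> - f y \<le> g y"
  shows "\<bar>f x\<bar> \<le> g \<bar>x\<bar>"
proof -
  have "f x = f (pprt x) + f (nprt x)"
    using prts[of x] linear_add[OF \<open>linear f\<close>] by metis
  then have "\<bar>f x\<bar> \<le> \<bar>f (pprt x)\<bar> + \<bar>f (- nprt x)\<bar>"
    by (metis abs_minus_cancel abs_triangle_ineq linear_neg[OF \<open>linear f\<close>])
  also have "\<dots> \<le> g (pprt x) + g (- nprt x)"
    by (intro add_mono abs_leI le) auto
  also have "\<dots> = g \<bar>x\<bar>"
    by (simp add: abs_prts linear_add[OF \<open>linear g\<close>, symmetric])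
  finally show ?thesis .
qed

lemma positive_linear_abs_le:
  assumes "positive_linear f"
  shows "\<bar>f x\<bar> \<le> f \<bar>x\<bar>"
proof (rule abs_le_if_dominated)
  show "linear f" "linear f"
    using assms unfolding positive_linear_def by blast+
  fix y :: 'a assume "0 \<le> y"
  then have "0 \<le> f y" using assms unfolding positive_linear_def by blast
  moreover from this have "- f y \<le> 0" by (simp only: neg_le_0_iff_le)
  ultimately show "- f y \<le> f y" by (rule order.trans[rotated])
qed (rule order_refl)

text \<open>If \<open>f\<close> is unbounded, pick \<open>x n\<close> of norm at most \<open>(1/2)^n\<close> with \<open>norm (f (x n)) > n\<close>.
  Then \<open>f\<close> takes at \<open>(\<Sum>n. \<bar>x n\<bar>)\<close> a value that dominates all \<open>\<bar>f (x n)\<bar>\<close>.\<close>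

lemma positive_linear_bounded:
  fixes f :: "'e::banach_lattice \<Rightarrow> 'e"
  assumes f: "positive_linear f"
  shows "bounded_linear f"
proof (rule ccontr)
  assume nb: "\<not> bounded_linear f"
  have lin: "linear f" using f by (simp add: positive_linear_def)
  have "\<exists>x. norm x \<le> (1/2)^n \<and> norm (f x) > real n" for n :: nat
  proof (rule ccontr)
    assume "\<not> ?thesis"
    then have b: "norm (f x) \<le> real n" if "norm x \<le> (1/2)^n" for x
      using that by force
    have "norm (f x) \<le> norm x * (real n * 2^n)" for x
    proof (cases "x = 0")
      case True then show ?thesis using lin by (simp add: linear_0)
    next
      case False
      \<comment> \<open>\<open>c\<close> rescales \<open>x\<close> to norm \<open>(1/2)^n\<close>,
        the largest at which \<open>b\<close> applies; undoing the scaling gives the operator bound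
        \<open>n * 2^n\<close>.\<close>
      define c where "c = (1/2)^n / norm x"
      have c: "c > 0" using False by (simp add: c_def)
      have "norm (c *\<^sub>R x) \<le> (1/2)^n" using False by (simp add: c_def)
      from b[OF this] have "c * norm (f x) \<le> real n"
        using lin c by (simp add: linear_scale)
      then have "norm (f x) \<le> real n / c"
        using c by (simp add: pos_le_divide_eq mult.commute)
      then show ?thesis by (simp add: c_def power_divide field_simps)
    qed
    then have "bounded_linear f"
      using lin by (auto simp: bounded_linear_def bounded_linear_axioms_def)
    with nb show False ..
  qed
  then obtain x where x: "\<And>n. norm (x n) \<le> (1/2)^n" "\<And>n. norm (f (x n)) > real n"
    by metis
  have "summable (\<lambda>n. norm \<bar>x n\<bar>)"
    by (rule summable_comparison_test'[OF summable_geometric[of "1/2::real"]]) (use x in auto)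
  then have sm: "summable (\<lambda>n. \<bar>x n\<bar>)" by (rule summable_norm_cancel)
  define s where "s = (\<Sum>n. \<bar>x n\<bar>)"
  have le: "\<bar>x n\<bar> \<le> s" for n
  proof -
    \<comment> \<open>The shift by \<open>Suc n\<close> makes every partial sum contain the term
      with index \<open>n\<close>; closedness of the cone carries the inequality to
      \<open>s\<close>.\<close>
    have "(\<lambda>m. sum (\<lambda>n. \<bar>x n\<bar>) {..<m + Suc n} - \<bar>x n\<bar>) \<longlonglongrightarrow> s - \<bar>x n\<bar>"
      unfolding s_def by (intro tendsto_diff tendsto_const LIMSEQ_ignore_initial_segment summable_LIMSEQ sm)
    moreover have "0 \<le> sum (\<lambda>n. \<bar>x n\<bar>) {..<m + Suc n} - \<bar>x n\<bar>" for m
      using sum_mono2[of "{..<m + Suc n}" "{n}" "\<lambda>n. \<bar>x n\<bar>"] by simp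
    ultimately have "0 \<le> s - \<bar>x n\<bar>" by (rule nonneg_limit)
    then show ?thesis by simp
  qed
  have "real n < norm (f s)" for n
  proof -
    have "\<bar>f (x n)\<bar> \<le> f s"
      using positive_linear_abs_le[OF f, of "x n"] positive_linear_mono[OF f le[of n]] by (rule order.trans)
    then have "norm (f (x n)) \<le> norm (f s)"
      by (intro norm_mono_abs) (metis abs_ge_self order.trans)
    with x(2)[of n] show ?thesis by simp
  qed
  then show False by (meson order.asym reals_Archimedean2)
qed

lemma positive_linear_blinfun:
  fixes f :: "'e::banach_lattice \<Rightarrow> 'e"
  assumes "positive_linear f"
  shows "\<exists>T. blinfun_apply T = f \<and> positive_op T \<and> T \<in> regular_ops"
proof -
  have "blinfun_apply (Blinfun f) = f"
    using positive_linear_bounded[OF assms] by (rule bounded_linear_Blinfun_apply)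
  moreover have "positive_linear (\<lambda>_. 0 :: 'e)"
    by (simp add: positive_linear_def linear_zero)
  ultimately show ?thesis
    using assms unfolding positive_op_def regular_ops_def
    by (intro exI[of _ "Blinfun f"] conjI CollectI exI[of _ f] exI[of _ "\<lambda>_. 0"]) auto
qed

section \<open>Order and algebra of bounded positive and regular operators\<close>

lemma linear_blinfun_apply: "linear (blinfun_apply T)"
  by (rule bounded_linear.linear[OF blinfun.bounded_linear_right])

lemma positive_op_iff: "positive_op T \<longleftrightarrow> (\<forall>x\<ge>0. 0 \<le> blinfun_apply T x)"
  by (simp add: positive_op_def positive_linear_def linear_blinfun_apply)

lemma positive_opD: "positive_op T \<Longrightarrow> 0 \<le> x \<Longrightarrow> 0 \<le> blinfun_apply T x"
  by (simp add: positive_op_iff)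

lemma positive_op_add: "positive_op S \<Longrightarrow> positive_op T \<Longrightarrow> positive_op (S + T)"
  by (simp add: positive_op_iff blinfun.add_left)

lemma positive_op_scaleR: "0 \<le> c \<Longrightarrow> positive_op T \<Longrightarrow> positive_op (c *\<^sub>R T)"
  by (simp add: positive_op_iff blinfun.scaleR_left scaleR_nonneg_nonneg)

lemma positive_op_compose: "positive_op S \<Longrightarrow> positive_op T \<Longrightarrow> positive_op (S o\<^sub>L T)"
  by (simp add: positive_op_iff)

lemma positive_op_sum: "(\<And>i. i \<in> I \<Longrightarrow> positive_op (T i)) \<Longrightarrow> positive_op (sum T I)"
  by (induction I rule: infinite_finite_induct) (simp_all add: positive_op_add positive_op_iff[of 0])

lemma positive_op_limit:
  assumes "T \<longlonglongrightarrow> S" and "\<And>n. positive_op (T n)"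
  shows "positive_op S"
  unfolding positive_op_iff
proof (intro allI impI)
  fix x :: 'a assume "0 \<le> x"
  have "(\<lambda>n. blinfun_apply (T n) x) \<longlonglongrightarrow> blinfun_apply S x"
    using assms(1) by (intro blinfun.tendsto tendsto_const)
  then show "0 \<le> blinfun_apply S x"
    by (rule nonneg_limit) (rule positive_opD[OF assms(2) \<open>0 \<le> x\<close>])
qed

lemma positive_op_antisym:
  assumes "positive_op (S - T)" and "positive_op (T - S)"
  shows "S = T"
proof (rule blinfun_eqI)
  fix x :: 'a
  obtain a b where ab: "0 \<le> a" "0 \<le> b" "x = a - b"
    using nonneg_difference by blast
  have "blinfun_apply S y = blinfun_apply T y" if "0 \<le> y" for y
    using positive_opD[OF assms(1) that] positive_opD[OF assms(2) that]
    unfolding blinfun.diff_left diff_ge_0_iff_ge by (rule order.antisym[rotated])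
  then show "blinfun_apply S x = blinfun_apply T x"
    using ab by (simp add: blinfun.diff_right)
qed

text \<open>Automatic continuity turns the two positive linear summands in the definition into
  bounded operators, so regularity can be handled inside the algebra of bounded operators.\<close>

lemma regular_ops_iff: "T \<in> regular_ops \<longleftrightarrow> (\<exists>S R. positive_op S \<and> positive_op R \<and> T = S - R)"
proof
  assume "T \<in> regular_ops"
  then obtain f g where fg: "positive_linear f" "positive_linear g" "\<And>x. blinfun_apply T x = f x - g x"
    by (auto simp: regular_ops_def)
  obtain S R where "blinfun_apply S = f" "positive_op S" "blinfun_apply R = g" "positive_op R"
    using positive_linear_blinfun[OF fg(1)] positive_linear_blinfun[OF fg(2)] by blast
  with fg show "\<exists>S R. positive_op S \<and> positive_op R \<and> T = S - R"
    by (intro exI[of _ S] exI[of _ R]) (auto intro!: blinfun_eqI simp: blinfun.diff_left)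
next
  assume "\<exists>S R. positive_op S \<and> positive_op R \<and> T = S - R"
  then obtain S R where "positive_op S" "positive_op R" "T = S - R" by blast
  then show "T \<in> regular_ops"
    unfolding regular_ops_def positive_op_def
    by (intro CollectI exI[of _ "blinfun_apply S"] exI[of _ "blinfun_apply R"]) (simp add: blinfun.diff_left)
qed

lemma positive_op_regular: "positive_op T \<Longrightarrow> T \<in> regular_ops"
  unfolding regular_ops_iff by (intro exI[of _ T] exI[of _ 0]) (simp add: positive_op_iff)

lemma regular_ops_diff: "S \<in> regular_ops \<Longrightarrow> T \<in> regular_ops \<Longrightarrow> S - T \<in> regular_ops"
  unfolding regular_ops_iff
proof (elim exE conjE)
  fix A B C D :: "'a \<Rightarrow>\<^sub>L 'a" assume "positive_op A" "positive_op B" "positive_op C" "positive_op D"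
    "S = A - B" "T = C - D"
  then show "\<exists>S' R. positive_op S' \<and> positive_op R \<and> S - T = S' - R"
    by (intro exI[of _ "A + D"] exI[of _ "B + C"]) (simp add: positive_op_add)
qed

lemma op_subalgebra_regular_ops: "op_subalgebra regular_ops"
  unfolding op_subalgebra_def subspace_def
proof (intro conjI ballI allI)
  show "(0 :: 'a \<Rightarrow>\<^sub>L 'a) \<in> regular_ops"
    by (simp add: positive_op_regular positive_op_iff)
next
  fix S T :: "'a \<Rightarrow>\<^sub>L 'a" assume "S \<in> regular_ops" "T \<in> regular_ops"
  then obtain A B C D where p: "positive_op A" "positive_op B" "positive_op C" "positive_op D"
    and eq: "S = A - B" "T = C - D"
    unfolding regular_ops_iff by blast
  show "S + T \<in> regular_ops" unfolding regular_ops_iff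
    using p eq by (intro exI[of _ "A + C"] exI[of _ "B + D"]) (simp add: positive_op_add)
  have "S o\<^sub>L T = ((A o\<^sub>L C) + (B o\<^sub>L D)) - ((A o\<^sub>L D) + (B o\<^sub>L C))"
    unfolding eq by (rule blinfun_eqI) (simp add: blinfun.bilinear_simps)
  then show "S o\<^sub>L T \<in> regular_ops" unfolding regular_ops_iff
    using p by (intro exI[of _ "(A o\<^sub>L C) + (B o\<^sub>L D)"] exI[of _ "(A o\<^sub>L D) + (B o\<^sub>L C)"])
      (simp add: positive_op_add positive_op_compose)
next
  fix c and S :: "'a \<Rightarrow>\<^sub>L 'a" assume "S \<in> regular_ops"
  then obtain A B where p: "positive_op A" "positive_op B" and eq: "S = A - B"
    unfolding regular_ops_iff by blast
  show "c *\<^sub>R S \<in> regular_ops"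
  proof (cases "0 \<le> c")
    case True
    then show ?thesis unfolding regular_ops_iff eq scaleR_diff_right
      by (intro exI[of _ "c *\<^sub>R A"] exI[of _ "c *\<^sub>R B"] conjI positive_op_scaleR p refl)
  next
    case False
    moreover have "c *\<^sub>R S = (- c) *\<^sub>R B - (- c) *\<^sub>R A"
      unfolding eq by (simp add: scaleR_diff_right)
    ultimately show ?thesis unfolding regular_ops_iff
      by (intro exI[of _ "(- c) *\<^sub>R B"] exI[of _ "(- c) *\<^sub>R A"] conjI positive_op_scaleR p) auto
  qed
qed

text \<open>The two positive operators add up to \<open>2 S\<close>.\<close>

lemma positive_op_if_dominating:
  assumes "positive_op (S - T)" and "positive_op (S + T)"
  shows "positive_op S"
proof -
  have "positive_op ((1/2) *\<^sub>R ((S - T) + (S + T)))"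
    by (intro positive_op_scaleR positive_op_add assms) simp
  then show ?thesis by (simp add: scaleR_2[symmetric])
qed

text \<open>Domination gives \<open>\<bar>T x\<bar> \<le> S \<bar>x\<bar>\<close> pointwise, and the
  lattice norm is monotone. Every operator norm estimate for the spectral integral goes through this
  passage from order to norm.\<close>

lemma norm_blinfun_le_dominated:
  assumes "positive_op (S - T)" and "positive_op (S + T)"
  shows "norm T \<le> norm S"
proof (rule norm_blinfun_bound)
  fix x
  have "\<bar>blinfun_apply T x\<bar> \<le> blinfun_apply S \<bar>x\<bar>"
  proof (rule abs_le_if_dominated)
    fix y :: 'a assume y: "0 \<le> y"
    show "blinfun_apply T y \<le> blinfun_apply S y"
      using positive_opD[OF assms(1) y] by (simp add: blinfun.diff_left)
    show "- blinfun_apply T y \<le> blinfun_apply S y"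
      using positive_opD[OF assms(2) y] add_le_cancel_right[of "- blinfun_apply T y" "blinfun_apply T y"]
      by (simp add: blinfun.add_left)
  qed (rule linear_blinfun_apply)+
  then have "norm (blinfun_apply T x) \<le> norm (blinfun_apply S \<bar>x\<bar>)"
    by (intro norm_mono_abs) (metis abs_ge_self order.trans)
  also have "\<dots> \<le> norm S * norm x"
    using norm_blinfun[of S "\<bar>x\<bar>"] by simp
  finally show "norm (blinfun_apply T x) \<le> norm S * norm x" .
qed simp

section \<open>The modulus and the regular norm\<close>

definition is_modulus :: "('e::banach_lattice \<Rightarrow>\<^sub>L 'e) \<Rightarrow> ('e \<Rightarrow>\<^sub>L 'e) \<Rightarrow> bool" where
  "is_modulus T S \<longleftrightarrow> S \<in> regular_ops \<and> positive_op (S - T) \<and> positive_op (S + T) \<and>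
     (\<forall>R\<in>regular_ops. positive_op (R - T) \<and> positive_op (R + T) \<longrightarrow> positive_op (R - S))"

text \<open>Antisymmetry of the operator order makes the definite description unique; existence is
  the separate content of \<open>modulus_exists\<close>.\<close>

lemma modulus_op_eq: "is_modulus T S \<Longrightarrow> modulus_op T = S"
  unfolding modulus_op_def is_modulus_def diff_minus_eq_add
  by (rule the_equality) (blast intro: positive_op_antisym)+

lemma is_modulus_positive_op: "positive_op T \<Longrightarrow> is_modulus T T"
  unfolding is_modulus_def by (auto simp: positive_op_regular positive_op_add, simp add: positive_op_iff)

text \<open>Kantorovich's extension: the cone spans the space, and \<open>f x\<close> is
  \<open>M\<close> of the positive part minus \<open>M\<close> of the negative part.\<close>

lemma additive_on_cone_extends:
  fixes M :: "'e::banach_lattice \<Rightarrow> 'e"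
  assumes nonneg: "\<And>x. 0 \<le> x \<Longrightarrow> 0 \<le> M x"
    and add: "\<And>x y. 0 \<le> x \<Longrightarrow> 0 \<le> y \<Longrightarrow> M (x + y) = M x + M y"
    and scale: "\<And>c x. 0 < c \<Longrightarrow> 0 \<le> x \<Longrightarrow> M (c *\<^sub>R x) = c *\<^sub>R M x"
  shows "\<exists>f. positive_linear f \<and> (\<forall>x\<ge>0. f x = M x)"
proof -
  define f where "f x = M (pprt x) - M (- nprt x)" for x
  \<comment> \<open>The value does not depend on how a vector is written as a difference of positive
    vectors, by additivity of \<open>M\<close> on the cross sums. Linearity can then be checked on
    whichever decomposition is convenient.\<close>
  have f_diff: "f (a - b) = M a - M b" if "0 \<le> a" "0 \<le> b" for a b
  proof -
    have "pprt (a - b) + b = a + - nprt (a - b)"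
      using prts[of "a - b"] by (simp add: algebra_simps)
    then have "M (pprt (a - b)) + M b = M a + M (- nprt (a - b))"
      using that by (metis add neg_0_le_iff_le nprt_le_zero zero_le_pprt)
    then show ?thesis by (simp add: f_def algebra_simps)
  qed
  have M0: "M 0 = 0" using add[of 0 0] by simp
  have eq: "f x = M x" if "0 \<le> x" for x
    using f_diff[of x 0] that by (simp add: M0)
  have "linear f"
  proof (rule linearI)
    fix x y :: 'e
    obtain a b c d where *: "0 \<le> a" "0 \<le> b" "x = a - b" "0 \<le> c" "0 \<le> d" "y = c - d"
      using nonneg_difference by meson
    have "x + y = (a + c) - (b + d)" using * by simp
    then show "f (x + y) = f x + f y" using * by (simp only: f_diff add_nonneg_nonneg add) simp
  next
    fix r :: real and x :: 'e
    obtain a b where *: "0 \<le> a" "0 \<le> b" "x = a - b"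
      using nonneg_difference by meson
    consider "r = 0" | "r > 0" | "- r > 0" by linarith
    then show "f (r *\<^sub>R x) = r *\<^sub>R f x"
    proof cases
      case 1 then show ?thesis by (simp add: eq M0)
    next
      case 2
      have "r *\<^sub>R x = r *\<^sub>R a - r *\<^sub>R b" using * by (simp add: scaleR_diff_right)
      then show ?thesis using * 2
        by (simp only: f_diff scaleR_nonneg_nonneg less_imp_le scale scaleR_diff_right)
    next
      case 3
      \<comment> \<open>A negative scalar exchanges the two positive parts.\<close>
      have "r *\<^sub>R x = (- r) *\<^sub>R b - (- r) *\<^sub>R a" using * by (simp add: scaleR_diff_right)
      then show ?thesis using * 3
        by (simp only: f_diff scaleR_nonneg_nonneg less_imp_le scale scaleR_diff_right) simp
    qed
  qed
  then show ?thesis using eq nonneg by (auto simp: positive_linear_def)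
qed

text \<open>Riesz--Kantorovich: \<open>T\<^sup>+ x = sup {T y | 0 \<le> y \<le> x}\<close> for \<open>x \<ge> 0\<close>, and \<open>2 T\<^sup>+ - T\<close> is the
  modulus.\<close>

lemma modulus_exists:
  fixes T :: "'e::banach_lattice \<Rightarrow>\<^sub>L 'e"
  assumes dc: "dedekind_complete TYPE('e)" and T: "T \<in> regular_ops"
  shows "\<exists>S. is_modulus T S"
proof -
  obtain A B where AB: "positive_op A" "positive_op B" "T = A - B"
    using T regular_ops_iff by blast
  \<comment> \<open>The supremum is kept as a relation, since it exists for \<open>x \<ge> 0\<close>
    only; \<open>M\<close> is chosen from it and its values off the cone are immaterial.\<close>
  define L where "L x s \<longleftrightarrow> (\<forall>y. 0 \<le> y \<and> y \<le> x \<longrightarrow> blinfun_apply T y \<le> s) \<and>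
     (\<forall>u. (\<forall>y. 0 \<le> y \<and> y \<le> x \<longrightarrow> blinfun_apply T y \<le> u) \<longrightarrow> s \<le> u)" for x s
  have "\<exists>s. L x s" if x: "0 \<le> x" for x
  proof -
    define D where "D = blinfun_apply T ` {y. 0 \<le> y \<and> y \<le> x}"
    have "D \<noteq> {}" using x by (auto simp: D_def)
    moreover have "bdd_above D"
    proof (rule bdd_aboveI[of _ "blinfun_apply A x"])
      fix z assume "z \<in> D"
      then obtain y where y: "0 \<le> y" "y \<le> x" "z = blinfun_apply A y - blinfun_apply B y"
        by (auto simp: D_def AB blinfun.diff_left)
      have "z \<le> blinfun_apply A y" using positive_opD[OF AB(2) y(1)] y by simp
      also have "\<dots> \<le> blinfun_apply A x"
        using positive_opD[OF AB(1), of "x - y"] y by (simp add: blinfun.diff_right)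
      finally show "z \<le> blinfun_apply A x" .
    qed
    ultimately obtain s where "\<forall>a\<in>D. a \<le> s" "\<forall>u. (\<forall>a\<in>D. a \<le> u) \<longrightarrow> s \<le> u"
      using dc unfolding dedekind_complete_def by blast
    then show ?thesis unfolding L_def D_def by (intro exI[of _ s]) auto
  qed
  then obtain M where M: "\<And>x. 0 \<le> x \<Longrightarrow> L x (M x)" by metis
  have ub: "blinfun_apply T y \<le> M x" if "0 \<le> y" "y \<le> x" for x y
    using M[of x] that unfolding L_def by (meson order.trans)
  have lub: "M x \<le> u" if "0 \<le> x" "\<And>y. 0 \<le> y \<Longrightarrow> y \<le> x \<Longrightarrow> blinfun_apply T y \<le> u" for x u
    using M[of x] that unfolding L_def by blast
  have nonneg: "0 \<le> M x" if "0 \<le> x" for x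
    using ub[of 0 x] that by simp
  have "M (x + z) = M x + M z" if x: "0 \<le> x" and z: "0 \<le> z" for x z
  proof (rule order.antisym)
    show "M (x + z) \<le> M x + M z"
    proof (rule lub)
      fix y assume y: "0 \<le> y" "y \<le> x + z"
      \<comment> \<open>Riesz decomposition: \<open>y\<close> splits into \<open>inf y x\<close>,
        which lies between 0 and \<open>x\<close>, and a remainder between 0 and
        \<open>z\<close>.\<close>
      have "y - inf y x = sup 0 (y - x)"
        by (simp add: diff_inf_eq_sup add_sup_distrib_left)
      then have "0 \<le> y - inf y x" "y - inf y x \<le> z"
        using y z by (auto simp: algebra_simps)
      then have "blinfun_apply T (inf y x) + blinfun_apply T (y - inf y x) \<le> M x + M z"
        using x y by (intro add_mono ub) auto
      then show "blinfun_apply T y \<le> M x + M z"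
        unfolding blinfun.diff_right by simp
    qed (use x z in auto)
    \<comment> \<open>The supremum over the first summand is taken with \<open>w\<close> fixed; the
      one over \<open>w\<close> follows.\<close>
    have *: "M x \<le> M (x + z) - blinfun_apply T w" if w: "0 \<le> w" "w \<le> z" for w
    proof (rule lub[OF x])
      fix y assume "0 \<le> y" "y \<le> x"
      then show "blinfun_apply T y \<le> M (x + z) - blinfun_apply T w"
        using ub[of "y + w" "x + z"] w
        by (simp add: le_diff_eq blinfun.add_right add_mono)
    qed
    have "M z \<le> M (x + z) - M x"
      by (rule lub[OF z]) (use * in \<open>auto simp: le_diff_eq add.commute\<close>)
    then show "M x + M z \<le> M (x + z)" by (simp add: le_diff_eq add.commute)
  qed
  moreover have "M (c *\<^sub>R x) = c *\<^sub>R M x" if c: "0 < c" and x: "0 \<le> x" for c x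
  proof -
    have le: "M (c *\<^sub>R x) \<le> c *\<^sub>R M x" if c: "0 < c" and x: "0 \<le> x" for c x
    proof (rule lub)
      fix y assume y: "0 \<le> y" "y \<le> c *\<^sub>R x"
      have "blinfun_apply T ((1/c) *\<^sub>R y) \<le> M x"
        using c y x scaleR_left_mono[OF y(2), of "1/c"]
        by (intro ub) (auto simp: scaleR_nonneg_nonneg)
      from scaleR_left_mono[OF this, of c] show "blinfun_apply T y \<le> c *\<^sub>R M x"
        using c by (simp add: blinfun.scaleR_right)
    qed (use c x in \<open>auto simp: scaleR_nonneg_nonneg\<close>)
    \<comment> \<open>The inequality \<open>le\<close> for the scalar \<open>1/c\<close> and the
      vector \<open>c *\<^sub>R x\<close> is the reverse inequality for \<open>c\<close>.\<close>
    have "c *\<^sub>R M ((1/c) *\<^sub>R c *\<^sub>R x) \<le> c *\<^sub>R ((1/c) *\<^sub>R M (c *\<^sub>R x))"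
      using c x by (intro scaleR_left_mono le) (auto simp: scaleR_nonneg_nonneg)
    with c have "c *\<^sub>R M x \<le> M (c *\<^sub>R x)" by simp
    with le[OF c x] show ?thesis by (rule order.antisym)
  qed
  ultimately obtain f where f: "positive_linear f" "\<And>x. 0 \<le> x \<Longrightarrow> f x = M x"
    using additive_on_cone_extends[of M] nonneg by blast
  obtain Q where Q: "blinfun_apply Q = f" "positive_op Q" "Q \<in> regular_ops"
    using positive_linear_blinfun[OF f(1)] by blast
  define S where "S = Q - (T - Q)"
  have QT: "positive_op (Q - T)"
    using ub Q f by (auto simp: positive_op_iff blinfun.diff_left)
  have eqs: "S - T = (Q - T) + (Q - T)" "S + T = Q + Q" by (simp_all add: S_def)
  have "positive_op (R - S)" if R: "positive_op (R - T)" "positive_op (R + T)" for R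
    unfolding positive_op_iff
  proof (intro allI impI)
    fix x :: 'e assume x: "0 \<le> x"
    \<comment> \<open>A dominator \<open>R\<close> of \<open>T\<close> and \<open>- T\<close>
      satisfies \<open>2 T y \<le> R y + T y \<le> R x + T x\<close> for
      \<open>0 \<le> y \<le> x\<close>. Hence the positive part of \<open>T\<close> is at most half
      of \<open>R + T\<close>, which rearranges to \<open>S \<le> R\<close>.\<close>
    have "f x \<le> (1/2) *\<^sub>R (blinfun_apply R x + blinfun_apply T x)"
      unfolding f(2)[OF x]
    proof (rule lub[OF x])
      fix y assume y: "0 \<le> y" "y \<le> x"
      have "2 *\<^sub>R blinfun_apply T y \<le> blinfun_apply R y + blinfun_apply T y"
        using positive_opD[OF R(1) y(1)] by (simp add: scaleR_2 blinfun.diff_left)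
      also have "\<dots> \<le> blinfun_apply R x + blinfun_apply T x"
        using positive_opD[OF R(2), of "x - y"] y
        by (simp add: blinfun.diff_right blinfun.add_left)
      finally have "(1/2) *\<^sub>R 2 *\<^sub>R blinfun_apply T y \<le> (1/2) *\<^sub>R (blinfun_apply R x + blinfun_apply T x)"
        by (intro scaleR_left_mono) auto
      then show "blinfun_apply T y \<le> (1/2) *\<^sub>R (blinfun_apply R x + blinfun_apply T x)" by simp
    qed
    from scaleR_left_mono[OF this, of 2]
    have "f x + f x \<le> blinfun_apply R x + blinfun_apply T x" by (simp add: scaleR_2)
    then show "0 \<le> blinfun_apply (R - S) x"
      unfolding S_def blinfun.diff_left Q(1) by (simp add: algebra_simps)
  qed
  then have "is_modulus T S"
    unfolding is_modulus_def eqs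
    using QT Q T by (auto intro: positive_op_add simp: S_def regular_ops_diff)
  then show ?thesis ..
qed

lemma is_modulus_modulus_op:
  fixes T :: "'e::banach_lattice \<Rightarrow>\<^sub>L 'e"
  assumes "dedekind_complete TYPE('e)" and "T \<in> regular_ops"
  shows "is_modulus T (modulus_op T)"
  using modulus_exists[OF assms] modulus_op_eq by metis

lemma norm_le_regular_norm:
  fixes T :: "'e::banach_lattice \<Rightarrow>\<^sub>L 'e"
  assumes "dedekind_complete TYPE('e)" and "T \<in> regular_ops"
  shows "norm T \<le> regular_norm T"
  using is_modulus_modulus_op[OF assms] unfolding regular_norm_def is_modulus_def
  by (intro norm_blinfun_le_dominated) auto

text \<open>A dominator \<open>S\<close> is positive, hence regular, so it lies above the least
  dominator, the modulus. Between positive operators the operator norm is monotone.\<close>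

lemma regular_norm_le:
  fixes T :: "'e::banach_lattice \<Rightarrow>\<^sub>L 'e"
  assumes "dedekind_complete TYPE('e)" and "T \<in> regular_ops"
    and "positive_op (S - T)" and "positive_op (S + T)"
  shows "regular_norm T \<le> norm S"
proof -
  define M where "M = modulus_op T"
  have M: "is_modulus T M" unfolding M_def by (rule is_modulus_modulus_op) fact+
  have "positive_op S" using assms(3,4) by (rule positive_op_if_dominating)
  then have "positive_op (S - M)"
    using M assms positive_op_regular unfolding is_modulus_def by blast
  moreover have "positive_op M"
    using M unfolding is_modulus_def by (blast intro: positive_op_if_dominating)
  ultimately show ?thesis
    unfolding regular_norm_def M_def[symmetric]
    using positive_op_add[of S M] \<open>positive_op S\<close> by (intro norm_blinfun_le_dominated)
qed

lemma regular_norm_positive_op: "positive_op T \<Longrightarrow> regular_norm T = norm T"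
  by (simp add: regular_norm_def modulus_op_eq[OF is_modulus_positive_op])

section \<open>Separation of points by functionals\<close>

text \<open>Hahn--Banach without extending functionals: a minimal sublinear functional is linear.\<close>

definition sublinear :: "('v::real_vector \<Rightarrow> real) \<Rightarrow> bool" where
  "sublinear p \<longleftrightarrow> (\<forall>x y. p (x + y) \<le> p x + p y) \<and> (\<forall>c\<ge>0. \<forall>x. p (c *\<^sub>R x) = c * p x)"

lemma sublinear_add: "sublinear p \<Longrightarrow> p (x + y) \<le> p x + p y"
  and sublinear_scaleR: "sublinear p \<Longrightarrow> 0 \<le> c \<Longrightarrow> p (c *\<^sub>R x) = c * p x"
  by (auto simp: sublinear_def)

lemma sublinear_0: "sublinear p \<Longrightarrow> p 0 = 0"
  using sublinear_scaleR[of p 0 0] by simp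

lemma sublinear_neg_le: "sublinear p \<Longrightarrow> - p (- x) \<le> p x"
  using sublinear_add[of p x "- x"] sublinear_0[of p] by simp

text \<open>The missing inequality for positive homogeneity is the given one for
  \<open>1 / c\<close> at \<open>c *\<^sub>R x\<close>.\<close>

lemma sublinearI:
  assumes add: "\<And>x y. p (x + y) \<le> p x + p y"
    and scale: "\<And>c x. 0 < c \<Longrightarrow> p (c *\<^sub>R x) \<le> c * p x" and zero: "p 0 = 0"
  shows "sublinear p"
  unfolding sublinear_def
proof (intro conjI allI impI add)
  fix c :: real and x assume "0 \<le> c"
  then consider "c = 0" | "0 < c" by linarith
  then show "p (c *\<^sub>R x) = c * p x"
  proof cases
    case 1 then show ?thesis by (simp add: zero)
  next
    case 2
    with scale[of "1 / c" "c *\<^sub>R x"] have "c * p x \<le> p (c *\<^sub>R x)"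
      by (simp add: field_simps)
    with scale[OF 2] show ?thesis by (intro order.antisym)
  qed
qed

text \<open>\<open>r\<close> is the infimum over \<open>t\<close> of the bound displayed, finite
  because \<open>t * q y \<le> q (- x) + q (x + t *\<^sub>R y)\<close>. The case
  \<open>t = 0\<close> gives \<open>r \<le> q\<close>. The case \<open>t = 1\<close> is the gain: if
  \<open>q\<close> is minimal then \<open>r = q\<close>, and it reads as superadditivity in the
  direction \<open>y\<close>.\<close>

lemma sublinear_decrease:
  fixes q :: "'v::real_vector \<Rightarrow> real"
  assumes q: "sublinear q"
  shows "\<exists>r. sublinear r \<and> (\<forall>x. \<forall>t\<ge>0. r x \<le> q (x + t *\<^sub>R y) - t * q y)"
proof -
  define r where "r x = (INF t\<in>{0..}. q (x + t *\<^sub>R y) - t * q y)" for x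
  have bdd: "bdd_below ((\<lambda>t. q (x + t *\<^sub>R y) - t * q y) ` {0..})" for x
  proof (rule bdd_belowI2[where m = "- q (- x)"])
    fix t :: real assume "t \<in> {0..}"
    then have "t * q y \<le> q (- x) + q (x + t *\<^sub>R y)"
      using sublinear_add[OF q, of "- x" "x + t *\<^sub>R y"] sublinear_scaleR[OF q, of t y] by simp
    then show "- q (- x) \<le> q (x + t *\<^sub>R y) - t * q y" by simp
  qed
  have le: "r x \<le> q (x + t *\<^sub>R y) - t * q y" if "t \<ge> 0" for x t
    unfolding r_def using that by (intro cINF_lower bdd) auto
  have ge: "m \<le> r x" if "\<And>t. t \<ge> 0 \<Longrightarrow> m \<le> q (x + t *\<^sub>R y) - t * q y" for m x
    unfolding r_def using that by (intro cINF_greatest) auto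
  have "sublinear r"
  proof (rule sublinearI)
    fix x z
    \<comment> \<open>Parameters \<open>t\<close> for \<open>x\<close> and \<open>s\<close> for
      \<open>z\<close> combine to \<open>t + s\<close> for \<open>x + z\<close>. The infimum over
      \<open>t\<close> is taken first, then the one over \<open>s\<close>.\<close>
    have "r (x + z) - (q (z + s *\<^sub>R y) - s * q y) \<le> r x" if s: "s \<ge> 0" for s
    proof (rule ge)
      fix t :: real assume t: "t \<ge> 0"
      have "r (x + z) \<le> q ((x + t *\<^sub>R y) + (z + s *\<^sub>R y)) - (t + s) * q y"
        using le[of "t + s" "x + z"] s t by (simp add: algebra_simps)
      also have "\<dots> \<le> q (x + t *\<^sub>R y) + q (z + s *\<^sub>R y) - (t + s) * q y"
        using sublinear_add[OF q] by simp
      finally show "r (x + z) - (q (z + s *\<^sub>R y) - s * q y) \<le> q (x + t *\<^sub>R y) - t * q y"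
        by (simp add: algebra_simps)
    qed
    then have "r (x + z) - r x \<le> r z"
      by (intro ge) (force simp: algebra_simps)
    then show "r (x + z) \<le> r x + r z" by simp
  next
    fix c :: real and x assume c: "0 < c"
    have "r (c *\<^sub>R x) / c \<le> r x"
    proof (rule ge)
      fix t :: real assume "t \<ge> 0"
      then have "r (c *\<^sub>R x) \<le> q (c *\<^sub>R (x + t *\<^sub>R y)) - c * t * q y"
        using le[of "c * t" "c *\<^sub>R x"] c by (simp add: algebra_simps)
      then have "r (c *\<^sub>R x) \<le> c * (q (x + t *\<^sub>R y) - t * q y)"
        using sublinear_scaleR[OF q, of c "x + t *\<^sub>R y"] c
        by (simp add: right_diff_distrib mult.assoc)
      then show "r (c *\<^sub>R x) / c \<le> q (x + t *\<^sub>R y) - t * q y"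
        using c by (simp add: field_simps)
    qed
    then show "r (c *\<^sub>R x) \<le> c * r x" using c by (simp add: field_simps)
  next
    have "r 0 \<le> 0" using le[of 0 0] sublinear_0[OF q] by simp
    moreover have "0 \<le> r 0" by (rule ge) (simp add: sublinear_scaleR[OF q])
    ultimately show "r 0 = 0" by simp
  qed
  then show ?thesis using le by blast
qed

text \<open>An infimum of sublinear functionals need not be subadditive. In a chain,
  \<open>q\<close> and \<open>r\<close> have a common lower member \<open>s\<close>, and
  \<open>s (x + y) \<le> s x + s y \<le> q x + r y\<close>.\<close>

lemma sublinear_chain_Inf:
  fixes C :: "('v::real_vector \<Rightarrow> real) set"
  assumes ne: "C \<noteq> {}" and sub: "\<And>q. q \<in> C \<Longrightarrow> sublinear q"
    and bdd: "\<And>x. bdd_below ((\<lambda>q. q x) ` C)"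
    and chain: "\<And>q r. q \<in> C \<Longrightarrow> r \<in> C \<Longrightarrow> (\<forall>x. q x \<le> r x) \<or> (\<forall>x. r x \<le> q x)"
  shows "sublinear (\<lambda>x. INF q\<in>C. q x)"
proof (rule sublinearI)
  have le: "(INF q\<in>C. q x) \<le> q x" if "q \<in> C" for x q
    using that by (intro cINF_lower bdd)
  show "(INF q\<in>C. q 0) = 0" using ne sub by (simp add: sublinear_0)
  fix x :: 'v
  show "(INF q\<in>C. q (x + y)) \<le> (INF q\<in>C. q x) + (INF q\<in>C. q y)" for y
  proof -
    have "(INF q\<in>C. q (x + y)) - r y \<le> (INF q\<in>C. q x)" if r: "r \<in> C" for r
    proof (rule cINF_greatest[OF ne])
      fix q assume q: "q \<in> C"
      obtain s where s: "s \<in> C" "\<forall>z. s z \<le> q z" "\<forall>z. s z \<le> r z"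
        using chain[OF q r] q r by blast
      have "(INF q\<in>C. q (x + y)) \<le> s x + s y"
        using le[OF s(1), of "x + y"] sublinear_add[OF sub[OF s(1)]] by (rule order.trans)
      also have "\<dots> \<le> q x + r y" using s by (intro add_mono) auto
      finally show "(INF q\<in>C. q (x + y)) - r y \<le> q x" by simp
    qed
    then have "(INF q\<in>C. q (x + y)) - (INF q\<in>C. q x) \<le> (INF q\<in>C. q y)"
      by (intro cINF_greatest[OF ne]) (force simp: algebra_simps)
    then show ?thesis by simp
  qed
  fix c :: real assume c: "0 < c"
  have "(INF q\<in>C. q (c *\<^sub>R x)) / c \<le> (INF q\<in>C. q x)"
  proof (rule cINF_greatest[OF ne])
    fix q assume q: "q \<in> C"
    then show "(INF q\<in>C. q (c *\<^sub>R x)) / c \<le> q x"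
      using le[OF q, of "c *\<^sub>R x"] sublinear_scaleR[OF sub[OF q], of c x] c
      by (simp add: field_simps)
  qed
  then show "(INF q\<in>C. q (c *\<^sub>R x)) \<le> c * (INF q\<in>C. q x)"
    using c by (simp add: field_simps)
qed

lemma linear_below_sublinear:
  fixes p :: "'v::real_vector \<Rightarrow> real"
  assumes p: "sublinear p"
  shows "\<exists>f. linear f \<and> (\<forall>x. f x \<le> p x)"
proof -
  define A where "A = {q. sublinear q \<and> (\<forall>x. q x \<le> p x)}"
  \<comment> \<open>The order is reversed, so a maximal element in the sense of Zorn's lemma is a
    minimal functional.\<close>
  define R where "R q r \<longleftrightarrow> (\<forall>x. r x \<le> q x)" for q r :: "'v \<Rightarrow> real"
  have "\<exists>m\<in>A. \<forall>a\<in>A. R m a \<longrightarrow> a = m"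
  proof (rule predicate_Zorn)
    show "partial_order_on A (relation_of R A)"
      by (rule partial_order_on_relation_ofI) (auto simp: R_def fun_eq_iff intro: order.trans order.antisym)
  next
    fix C assume C: "C \<in> Chains (relation_of R A)"
    then have CA: "C \<subseteq> A"
      by (auto simp: Chains_def relation_of_def)
    show "\<exists>u\<in>A. \<forall>a\<in>C. R a u"
    proof (cases "C = {}")
      case True
      then show ?thesis using p by (auto simp: A_def)
    next
      case ne: False
      have bdd: "bdd_below ((\<lambda>q. q x) ` C)" for x
      proof (rule bdd_belowI2[where m = "- p (- x)"])
        fix q assume "q \<in> C"
        with CA have q: "sublinear q" "q (- x) \<le> p (- x)" by (auto simp: A_def)
        show "- p (- x) \<le> q x"
          using sublinear_neg_le[OF q(1), of x] q(2) by simp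
      qed
      define u where "u x = (INF q\<in>C. q x)" for x
      have le: "u x \<le> q x" if "q \<in> C" for x q
        unfolding u_def using that by (intro cINF_lower bdd)
      have "sublinear u" unfolding u_def
      proof (rule sublinear_chain_Inf[OF ne _ bdd])
        show "sublinear q" if "q \<in> C" for q using CA that by (auto simp: A_def)
        show "(\<forall>x. q x \<le> r x) \<or> (\<forall>x. r x \<le> q x)" if "q \<in> C" "r \<in> C" for q r
          using C that by (auto simp: Chains_def relation_of_def R_def)
      qed
      moreover obtain q where "q \<in> C" using ne by blast
      then have "u x \<le> p x" for x
        using le[of q x] CA by (force simp: A_def intro: order.trans)
      ultimately show ?thesis using le by (auto simp: A_def R_def intro!: bexI[of _ u])
    qed
  qed
  then obtain f where fA: "f \<in> A" and fR: "\<And>r. r \<in> A \<Longrightarrow> R f r \<Longrightarrow> r = f"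
    by blast
  have f: "sublinear f" "\<And>x. f x \<le> p x" using fA by (auto simp: A_def)
  have min: "r = f" if "sublinear r" "\<And>x. r x \<le> f x" for r
    using that f(2) by (intro fR) (auto simp: A_def R_def intro: order.trans)
  have add: "f (x + y) = f x + f y" for x y
  proof -
    obtain r where r: "sublinear r" "\<And>x t. t \<ge> 0 \<Longrightarrow> r x \<le> f (x + t *\<^sub>R y) - t * f y"
      using sublinear_decrease[OF f(1), of y] by blast
    \<comment> \<open>The choice \<open>t = 0\<close> shows \<open>r \<le> f\<close>, so minimality
      forces equality; then \<open>t = 1\<close> supplies the inequality opposite to
      subadditivity.\<close>
    have "r = f" using r(2)[of 0] by (intro min r) simp
    with r(2)[of 1 x] have "f x \<le> f (x + y) - f y" by simp
    with sublinear_add[OF f(1), of x y] show ?thesis by simp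
  qed
  have neg: "f (- x) = - f x" for x
    using add[of x "- x"] sublinear_0[OF f(1)] by simp
  have "linear f"
  proof (rule linearI[OF add])
    fix c :: real and x
    show "f (c *\<^sub>R x) = c *\<^sub>R f x"
    proof (cases "c \<ge> 0")
      case True then show ?thesis by (simp add: sublinear_scaleR[OF f(1)])
    next
      case False
      then have "f ((- c) *\<^sub>R x) = (- c) * f x" by (intro sublinear_scaleR[OF f(1)]) simp
      then show ?thesis using neg[of "c *\<^sub>R x"] by simp
    qed
  qed
  with f show ?thesis by blast
qed

text \<open>Lowering the norm in the direction \<open>v\<close> gives a sublinear \<open>p\<close>
  with \<open>p (- v) \<le> - norm v\<close>. A linear \<open>f\<close> below \<open>p\<close> is
  bounded by the norm and satisfies \<open>f v \<ge> norm v\<close>.\<close>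

lemma blinfun_separates_zero:
  fixes v :: "'v::real_normed_vector"
  assumes "\<And>x' :: 'v \<Rightarrow>\<^sub>L real. blinfun_apply x' v = 0"
  shows "v = 0"
proof -
  have "sublinear (norm :: 'v \<Rightarrow> real)"
    by (auto simp: sublinear_def norm_triangle_ineq)
  from sublinear_decrease[OF this, of v] obtain p where p: "sublinear p"
    "\<And>x t. t \<ge> 0 \<Longrightarrow> p x \<le> norm (x + t *\<^sub>R v) - t * norm v"
    by blast
  obtain f where f: "linear f" "\<And>x. f x \<le> p x"
    using linear_below_sublinear[OF p(1)] by blast
  have le: "f x \<le> norm x" for x
    using f(2)[of x] p(2)[of 0 x] by simp
  have "norm (f x) \<le> norm x * 1" for x
    using le[of x] le[of "- x"] linear_neg[OF f(1), of x] by simp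
  then have "bounded_linear f"
    using f(1) unfolding bounded_linear_def bounded_linear_axioms_def by blast
  then have "f v = 0"
    using assms[of "Blinfun f"] by (simp add: bounded_linear_Blinfun_apply)
  moreover have "f (- v) \<le> - norm v"
    using f(2)[of "- v"] p(2)[of 1 "- v"] by simp
  ultimately show "v = 0"
    using linear_neg[OF f(1), of v] by simp
qed

lemma blinfun_eq_if_weakly_eq:
  fixes S T :: "'u::real_normed_vector \<Rightarrow>\<^sub>L 'v::real_normed_vector"
  assumes "\<And>x (x' :: 'v \<Rightarrow>\<^sub>L real). blinfun_apply x' (blinfun_apply S x) = blinfun_apply x' (blinfun_apply T x)"
  shows "S = T"
proof (rule blinfun_eqI)
  fix x
  have "blinfun_apply S x - blinfun_apply T x = 0"
    by (rule blinfun_separates_zero) (simp add: blinfun.diff_right assms)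
  then show "blinfun_apply S x = blinfun_apply T x" by simp
qed

section \<open>Integration with respect to finite signed measures\<close>

text \<open>The bound \<open>B\<close> keeps the suprema that define the variations finite. For the
  scalar measures of a spectral measure it comes from
  \<open>norm (P A) \<le> norm (P X)\<close>.\<close>

locale bounded_signed_measure = sigma_algebra X \<Omega> for X :: "'a set" and \<Omega> +
  fixes \<mu> :: "'a set \<Rightarrow> real" and B :: real
  assumes empty: "\<mu> {} = 0"
    and sums: "\<And>D. range D \<subseteq> \<Omega> \<Longrightarrow> disjoint_family D \<Longrightarrow> (\<lambda>n::nat. \<mu> (D n)) sums \<mu> (\<Union>n. D n)"
    and bounded: "\<And>A. A \<in> \<Omega> \<Longrightarrow> \<bar>\<mu> A\<bar> \<le> B"
begin

lemma additive:
  assumes "A \<in> \<Omega>" "C \<in> \<Omega>" "A \<inter> C = {}"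
  shows "\<mu> (A \<union> C) = \<mu> A + \<mu> C"
proof -
  have "(\<lambda>n. \<mu> (binaryset A C n)) sums \<mu> (\<Union>n. binaryset A C n)"
    using assms by (intro sums) (auto simp: range_binaryset_eq disjoint_family_on_def binaryset_def)
  with binaryset_sums[of \<mu> A C] empty show ?thesis
    by (simp add: UN_binaryset_eq sums_unique2)
qed

definition var :: "'a set \<Rightarrow> real" where
  "var \<Delta> = (SUP A\<in>{A\<in>\<Omega>. A \<subseteq> \<Delta>}. \<mu> A)"

lemma var_upper: "A \<in> \<Omega> \<Longrightarrow> A \<subseteq> \<Delta> \<Longrightarrow> \<mu> A \<le> var \<Delta>"
  unfolding var_def using bounded
  by (intro cSUP_upper bdd_aboveI2[where M = B]) (auto simp: abs_le_iff)

lemma var_least: "(\<And>A. A \<in> \<Omega> \<Longrightarrow> A \<subseteq> \<Delta> \<Longrightarrow> \<mu> A \<le> u) \<Longrightarrow> var \<Delta> \<le> u"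
  unfolding var_def by (intro cSUP_least) auto

lemma var_nonneg: "0 \<le> var \<Delta>"
  using var_upper[of "{}" \<Delta>] empty by simp

lemma var_empty: "var {} = 0"
  using var_nonneg[of "{}"] empty by (intro order.antisym var_least) auto

lemma var_mono: "\<Delta> \<subseteq> \<Gamma> \<Longrightarrow> var \<Delta> \<le> var \<Gamma>"
  by (intro var_least var_upper) auto

text \<open>Competitors \<open>A\<close> in \<Delta> and \<open>C\<close> in \<Gamma> are disjoint,
  so their union competes in the supremum for \<open>\<Delta> \<union> \<Gamma>\<close> with value
  \<open>\<mu> A + \<mu> C\<close>.\<close>

lemma var_superadditive:
  assumes "\<Delta> \<inter> \<Gamma> = {}"
  shows "var \<Delta> + var \<Gamma> \<le> var (\<Delta> \<union> \<Gamma>)"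
proof -
  have "var \<Delta> \<le> var (\<Delta> \<union> \<Gamma>) - \<mu> C" if C: "C \<in> \<Omega>" "C \<subseteq> \<Gamma>" for C
  proof (rule var_least)
    fix A assume A: "A \<in> \<Omega>" "A \<subseteq> \<Delta>"
    have "\<mu> A + \<mu> C = \<mu> (A \<union> C)"
      using A C assms by (intro additive[symmetric]) auto
    also have "\<dots> \<le> var (\<Delta> \<union> \<Gamma>)"
      using A C by (intro var_upper) auto
    finally show "\<mu> A \<le> var (\<Delta> \<union> \<Gamma>) - \<mu> C" by simp
  qed
  then have "var \<Gamma> \<le> var (\<Delta> \<union> \<Gamma>) - var \<Delta>"
    by (intro var_least) (force simp: algebra_simps)
  then show ?thesis by simp
qed

text \<open>Superadditivity on finite unions bounds the series from above. Conversely, a measurable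
  subset \<open>A\<close> of the union is cut into the pieces \<open>A \<inter> D n\<close>, and
  countable additivity of \<mu> bounds \<open>\<mu> A\<close> by the series.\<close>

lemma var_countably_additive:
  assumes D: "range D \<subseteq> \<Omega>" "disjoint_family D"
  shows "(\<Sum>n::nat. ennreal (var (D n))) = ennreal (var (\<Union>n. D n))"
proof -
  have "(\<Sum>n<N. var (D n)) \<le> var (\<Union>n<N. D n)" for N
  proof (induction N)
    case (Suc N)
    have "D n \<inter> D N = {}" if "n < N" for n
      using D(2) that by (simp add: disjoint_family_on_def)
    then have "(\<Union>n<N. D n) \<inter> D N = {}" by blast
    from var_superadditive[OF this] Suc show ?case
      by (simp add: lessThan_Suc Un_commute)
  qed (simp add: var_empty)
  then have le: "(\<Sum>n<N. var (D n)) \<le> var (\<Union>n. D n)" for N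
    by (rule order.trans) (auto intro!: var_mono)
  then have sm: "summable (\<lambda>n. var (D n))"
    by (intro summableI_nonneg_bounded) (auto simp: var_nonneg)
  have "var (\<Union>n. D n) \<le> (\<Sum>n. var (D n))"
  proof (rule var_least)
    fix A assume A: "A \<in> \<Omega>" "A \<subseteq> (\<Union>n. D n)"
    have "(\<lambda>n. \<mu> (A \<inter> D n)) sums \<mu> (\<Union>n. A \<inter> D n)"
      using D A by (intro sums) (auto simp: disjoint_family_on_def)
    moreover have "(\<Union>n. A \<inter> D n) = A" using A by auto
    ultimately have A_sums: "(\<lambda>n. \<mu> (A \<inter> D n)) sums \<mu> A" by simp
    have "\<mu> (A \<inter> D n) \<le> var (D n)" for n
      using A(1) D(1) by (intro var_upper Int) auto
    then show "\<mu> A \<le> (\<Sum>n. var (D n))"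
      by (rule sums_le[OF _ A_sums summable_sums[OF sm]])
  qed
  moreover have "(\<Sum>n. var (D n)) \<le> var (\<Union>n. D n)"
    by (rule suminf_le_const[OF sm le])
  ultimately have "(\<Sum>n. var (D n)) = var (\<Union>n. D n)" by (rule order.antisym[rotated])
  then show ?thesis
    using suminf_ennreal2[OF var_nonneg sm] by simp
qed

lemma space_positive_variation [simp]: "space (positive_variation X \<Omega> \<mu>) = X"
  and sets_positive_variation [simp, measurable_cong]: "sets (positive_variation X \<Omega> \<mu>) = \<Omega>"
  using space_closed by (simp_all add: positive_variation_def space_measure_of sets_measure_of sigma_sets_eq)

lemma emeasure_positive_variation:
  "A \<in> \<Omega> \<Longrightarrow> emeasure (positive_variation X \<Omega> \<mu>) A = ennreal (var A)"
  unfolding positive_variation_def var_def[symmetric]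
  by (rule emeasure_measure_of_sigma[OF sigma_algebra_axioms])
    (auto simp: positive_def var_empty intro!: countably_additiveI var_countably_additive)

lemma measure_positive_variation:
  "A \<in> \<Omega> \<Longrightarrow> measure (positive_variation X \<Omega> \<mu>) A = var A"
  by (simp add: measure_def emeasure_positive_variation var_nonneg)

lemma finite_measure_positive_variation: "finite_measure (positive_variation X \<Omega> \<mu>)"
  by (rule finite_measureI) (simp add: emeasure_positive_variation)

lemma uminus: "bounded_signed_measure X \<Omega> (\<lambda>\<Delta>. - \<mu> \<Delta>) B"
proof unfold_locales
  show "(\<lambda>n. - \<mu> (D n)) sums (- \<mu> (\<Union>n. D n))"
    if "range D \<subseteq> \<Omega>" "disjoint_family D" for D :: "nat \<Rightarrow> 'a set"
    using that by (intro sums_minus sums)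
qed (simp_all add: empty bounded)

text \<open>Complementation inside \<open>A\<close> matches the two suprema:
  \<open>\<mu> C = \<mu> A - \<mu> (A - C)\<close>, so a competitor for \<mu> corresponds to a
  competitor for \<open>- \<mu>\<close>, shifted by \<open>\<mu> A\<close>.\<close>

lemma jordan_decomposition:
  assumes A: "A \<in> \<Omega>"
  shows "measure (positive_variation X \<Omega> \<mu>) A - measure (positive_variation X \<Omega> (\<lambda>\<Delta>. - \<mu> \<Delta>)) A = \<mu> A"
proof -
  interpret neg: bounded_signed_measure X \<Omega> "\<lambda>\<Delta>. - \<mu> \<Delta>" B by (rule uminus)
  have split: "\<mu> A = \<mu> C + \<mu> (A - C)" if "C \<in> \<Omega>" "C \<subseteq> A" for C
    using additive[of C "A - C"] that A by (auto simp: Un_absorb1)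
  have "neg.var A \<le> var A - \<mu> A"
  proof (rule neg.var_least)
    fix C assume C: "C \<in> \<Omega>" "C \<subseteq> A"
    have "\<mu> (A - C) \<le> var A" using A C by (intro var_upper) auto
    with split[OF C] show "- \<mu> C \<le> var A - \<mu> A" by simp
  qed
  moreover have "var A \<le> neg.var A + \<mu> A"
  proof (rule var_least)
    fix C assume C: "C \<in> \<Omega>" "C \<subseteq> A"
    have "- \<mu> (A - C) \<le> neg.var A" using A C by (intro neg.var_upper) auto
    with split[OF C] show "\<mu> C \<le> neg.var A + \<mu> A" by simp
  qed
  ultimately show ?thesis
    by (simp add: measure_positive_variation neg.measure_positive_variation A)
qed

lemma integrable_positive_variation:
  assumes "f \<in> bounded_measurable X \<Omega>"
  shows "integrable (positive_variation X \<Omega> \<mu>) f"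
proof -
  interpret finite_measure "positive_variation X \<Omega> \<mu>" by (rule finite_measure_positive_variation)
  have "borel_measurable (positive_variation X \<Omega> \<mu>) = (borel_measurable (sigma X \<Omega>) :: ('a \<Rightarrow> real) set)"
    using space_closed by (intro measurable_cong_sets) (simp_all add: sigma_sets_eq)
  then have "f \<in> borel_measurable (positive_variation X \<Omega> \<mu>)"
    using assms unfolding bounded_measurable_def by blast
  moreover obtain c where "\<And>\<xi>. \<xi> \<in> X \<Longrightarrow> \<bar>f \<xi>\<bar> \<le> c"
    using assms by (auto simp: bounded_measurable_def bounded_iff)
  ultimately show ?thesis
    by (intro integrable_const_bound[where B = c]) auto
qed

lemma signed_integral_add:
  assumes "f \<in> bounded_measurable X \<Omega>" "g \<in> bounded_measurable X \<Omega>"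
  shows "signed_integral X \<Omega> \<mu> (\<lambda>\<xi>. f \<xi> + g \<xi>) = signed_integral X \<Omega> \<mu> f + signed_integral X \<Omega> \<mu> g"
proof -
  interpret neg: bounded_signed_measure X \<Omega> "\<lambda>\<Delta>. - \<mu> \<Delta>" B by (rule uminus)
  show ?thesis
    unfolding signed_integral_def
      Bochner_Integration.integral_add[OF assms[THEN integrable_positive_variation]]
      Bochner_Integration.integral_add[OF assms[THEN neg.integrable_positive_variation]]
    by simp
qed

lemma signed_integral_scale:
  "signed_integral X \<Omega> \<mu> (\<lambda>\<xi>. c * f \<xi>) = c * signed_integral X \<Omega> \<mu> f"
  unfolding signed_integral_def integral_mult_right_zero right_diff_distrib ..

lemma signed_integral_indicator:
  "A \<in> \<Omega> \<Longrightarrow> signed_integral X \<Omega> \<mu> (indicator A) = \<mu> A"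
  using jordan_decomposition[of A] sets_into_space[of A]
  unfolding signed_integral_def
  by (simp add: bounded_signed_measure.space_positive_variation[OF uminus] Int_absorb1 Int_absorb2)

lemma signed_integral_dominated_convergence:
  assumes f: "f \<in> bounded_measurable X \<Omega>" and g: "\<And>n. g n \<in> bounded_measurable X \<Omega>"
    and lim: "\<And>\<xi>. \<xi> \<in> X \<Longrightarrow> (\<lambda>n. g n \<xi>) \<longlonglongrightarrow> f \<xi>" and K: "\<And>n \<xi>. \<bar>g n \<xi>\<bar> \<le> K"
  shows "(\<lambda>n. signed_integral X \<Omega> \<mu> (g n)) \<longlonglongrightarrow> signed_integral X \<Omega> \<mu> f"
proof -
  \<comment> \<open>An arbitrary \<nu> is used so that the same argument serves both \<mu> and
    \<open>- \<mu>\<close>.\<close>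
  have *: "(\<lambda>n. integral\<^sup>L (positive_variation X \<Omega> \<nu>) (g n)) \<longlonglongrightarrow> integral\<^sup>L (positive_variation X \<Omega> \<nu>) f"
    if "bounded_signed_measure X \<Omega> \<nu> B" for \<nu>
  proof -
    interpret nu: bounded_signed_measure X \<Omega> \<nu> B by fact
    interpret finite_measure "positive_variation X \<Omega> \<nu>" by (rule nu.finite_measure_positive_variation)
    show ?thesis
    proof (rule integral_dominated_convergence[where w = "\<lambda>_. K"])
      show "f \<in> borel_measurable (positive_variation X \<Omega> \<nu>)"
        by (rule borel_measurable_integrable[OF nu.integrable_positive_variation[OF f]])
      show "g n \<in> borel_measurable (positive_variation X \<Omega> \<nu>)" for n
        by (rule borel_measurable_integrable[OF nu.integrable_positive_variation[OF g]])
      show "integrable (positive_variation X \<Omega> \<nu>) (\<lambda>_. K)"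
        by simp
      show "AE \<xi> in positive_variation X \<Omega> \<nu>. (\<lambda>n. g n \<xi>) \<longlonglongrightarrow> f \<xi>"
        by (rule AE_I2) (simp add: lim)
      show "AE \<xi> in positive_variation X \<Omega> \<nu>. norm (g n \<xi>) \<le> K" for n
        using K by simp
    qed
  qed
  show ?thesis
    unfolding signed_integral_def
    by (intro tendsto_diff * bounded_signed_measure_axioms uminus)
qed

end

section \<open>Bounded measurable functions and their approximation by simple functions\<close>

lemma bounded_measurable_le_sup_norm:
  assumes "f \<in> bounded_measurable X \<Omega>"
  shows "\<bar>f \<xi>\<bar> \<le> sup_norm f"
proof -
  obtain c where "\<And>\<xi>. \<xi> \<in> X \<Longrightarrow> \<bar>f \<xi>\<bar> \<le> c"
    using assms by (auto simp: bounded_measurable_def bounded_iff)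
  \<comment> \<open>Points outside \<open>X\<close> contribute the value 0, and for empty
    \<open>X\<close> the constant \<open>c\<close> may be negative.\<close>
  then have "\<bar>f \<xi>\<bar> \<le> max c 0" for \<xi>
    using assms by (cases "\<xi> \<in> X") (force simp: bounded_measurable_def)+
  then show ?thesis
    unfolding sup_norm_def by (intro cSUP_upper bdd_aboveI2) auto
qed

lemma sup_norm_le: "(\<And>\<xi>. \<bar>f \<xi>\<bar> \<le> c) \<Longrightarrow> sup_norm f \<le> c"
  unfolding sup_norm_def by (intro cSUP_least) auto

context sigma_algebra
begin

lemma bounded_measurableI:
  assumes "f \<in> borel_measurable (sigma \<Omega> M)" "\<And>\<xi>. \<xi> \<in> \<Omega> \<Longrightarrow> \<bar>f \<xi>\<bar> \<le> c" "\<And>\<xi>. \<xi> \<notin> \<Omega> \<Longrightarrow> f \<xi> = 0"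
  shows "f \<in> bounded_measurable \<Omega> M"
  using assms by (auto simp: bounded_measurable_def bounded_iff)

lemma bounded_measurable_add:
  assumes f: "f \<in> bounded_measurable \<Omega> M" and g: "g \<in> bounded_measurable \<Omega> M"
  shows "(\<lambda>\<xi>. f \<xi> + g \<xi>) \<in> bounded_measurable \<Omega> M"
proof (rule bounded_measurableI)
  show "\<bar>f \<xi> + g \<xi>\<bar> \<le> sup_norm f + sup_norm g" for \<xi>
    using bounded_measurable_le_sup_norm[OF f, of \<xi>] bounded_measurable_le_sup_norm[OF g, of \<xi>] by linarith
qed (use f g in \<open>auto simp: bounded_measurable_def\<close>)

lemma bounded_measurable_mult:
  assumes f: "f \<in> bounded_measurable \<Omega> M" and g: "g \<in> bounded_measurable \<Omega> M"
  shows "(\<lambda>\<xi>. f \<xi> * g \<xi>) \<in> bounded_measurable \<Omega> M"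
proof (rule bounded_measurableI)
  show "\<bar>f \<xi> * g \<xi>\<bar> \<le> sup_norm f * sup_norm g" for \<xi>
    unfolding abs_mult
    using bounded_measurable_le_sup_norm[OF f, of \<xi>] bounded_measurable_le_sup_norm[OF g, of \<xi>]
    by (intro mult_mono) auto
qed (use f g in \<open>auto simp: bounded_measurable_def\<close>)

lemma bounded_measurable_scale:
  assumes f: "f \<in> bounded_measurable \<Omega> M"
  shows "(\<lambda>\<xi>. c * f \<xi>) \<in> bounded_measurable \<Omega> M"
proof (rule bounded_measurableI)
  show "\<bar>c * f \<xi>\<bar> \<le> \<bar>c\<bar> * sup_norm f" for \<xi>
    using bounded_measurable_le_sup_norm[OF f, of \<xi>] by (simp add: abs_mult mult_left_mono)
qed (use f in \<open>auto simp: bounded_measurable_def\<close>)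

lemma bounded_measurable_diff:
  assumes "f \<in> bounded_measurable \<Omega> M" "g \<in> bounded_measurable \<Omega> M"
  shows "(\<lambda>\<xi>. f \<xi> - g \<xi>) \<in> bounded_measurable \<Omega> M"
  using bounded_measurable_add[OF assms(1) bounded_measurable_scale[OF assms(2), of "- 1"]] by simp

lemma simple_function_sigma_iff:
  "simple_function (sigma \<Omega> M) f \<longleftrightarrow> finite (f ` \<Omega>) \<and> (\<forall>v\<in>f ` \<Omega>. f -` {v} \<inter> \<Omega> \<in> M)"
  using space_closed by (simp add: simple_function_def sets_measure_of sigma_sets_eq space_measure_of)

lemma simple_subset_bounded_measurable: "simple_functions \<Omega> M \<subseteq> bounded_measurable \<Omega> M"
proof
  fix f assume "f \<in> simple_functions \<Omega> M"
  then have "simple_function (sigma \<Omega> M) f" and zero: "\<forall>\<xi>. \<xi> \<notin> \<Omega> \<longrightarrow> f \<xi> = 0"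
    by (auto simp: simple_functions_def)
  then have "f \<in> borel_measurable (sigma \<Omega> M)" "finite (f ` \<Omega>)"
    by (auto intro: borel_measurable_simple_function simp: simple_function_sigma_iff)
  with zero show "f \<in> bounded_measurable \<Omega> M"
    by (auto simp: bounded_measurable_def finite_imp_bounded)
qed

lemma indicator_simple: "A \<in> M \<Longrightarrow> indicator A \<in> simple_functions \<Omega> M"
  using sets_into_space[of A] space_closed
  by (auto simp: simple_functions_def sets_measure_of sigma_sets_eq indicator_def)

lemma indicator_bounded_measurable: "A \<in> M \<Longrightarrow> indicator A \<in> bounded_measurable \<Omega> M"
  using indicator_simple simple_subset_bounded_measurable by blast

lemma simple_functions_diff:
  assumes "f \<in> simple_functions \<Omega> M" "g \<in> simple_functions \<Omega> M"
  shows "(\<lambda>\<xi>. f \<xi> - g \<xi>) \<in> simple_functions \<Omega> M"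
  using assms by (auto simp: simple_functions_def)

lemma simple_functions_scale:
  assumes "f \<in> simple_functions \<Omega> M"
  shows "(\<lambda>\<xi>. c * f \<xi>) \<in> simple_functions \<Omega> M"
  using assms by (auto simp: simple_functions_def)

text \<open>The coefficients in the level-set form are values of \<open>f\<close>. For nonnegative
  \<open>f\<close> they are nonnegative, which is the source of positivity of the integral.\<close>

lemma simple_functions_canonical:
  assumes "f \<in> simple_functions \<Omega> M"
  shows "f = (\<lambda>\<xi>. \<Sum>v\<in>f ` \<Omega>. v * indicator (f -` {v} \<inter> \<Omega>) \<xi>)"
proof
  fix \<xi>
  have fin: "finite (f ` \<Omega>)"
    using assms by (auto simp: simple_functions_def simple_function_sigma_iff)
  show "f \<xi> = (\<Sum>v\<in>f ` \<Omega>. v * indicator (f -` {v} \<inter> \<Omega>) \<xi>)"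
  proof (cases "\<xi> \<in> \<Omega>")
    case True
    have "(\<Sum>v\<in>f ` \<Omega>. v * indicator (f -` {v} \<inter> \<Omega>) \<xi>) = (\<Sum>v\<in>f ` \<Omega>. if v = f \<xi> then v else 0)"
      using True by (intro sum.cong) (auto simp: indicator_def)
    then show ?thesis using True fin by simp
  next
    case False
    then show ?thesis using assms by (simp add: simple_functions_def)
  qed
qed

text \<open>Rounding \<open>f\<close> down to multiples of \<open>1 / Suc n\<close> keeps
  nonnegativity and the value 0 off \<open>X\<close>, and boundedness of \<open>f\<close> leaves
  finitely many values.\<close>

lemma bounded_measurable_approx:
  assumes f: "f \<in> bounded_measurable \<Omega> M"
  shows "\<exists>s. (\<forall>n. s n \<in> simple_functions \<Omega> M) \<and> (\<forall>n \<xi>. \<bar>s n \<xi> - f \<xi>\<bar> \<le> 1 / real (Suc n)) \<and>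
    ((\<forall>\<xi>. 0 \<le> f \<xi>) \<longrightarrow> (\<forall>n \<xi>. 0 \<le> s n \<xi>))"
proof (intro exI conjI allI impI)
  let ?s = "\<lambda>n \<xi>. real_of_int \<lfloor>real (Suc n) * f \<xi>\<rfloor> / real (Suc n)"
  fix n
  have m: "f \<in> borel_measurable (sigma \<Omega> M)" using f by (simp add: bounded_measurable_def)
  show "?s n \<in> simple_functions \<Omega> M"
  proof -
    have "?s n \<in> borel_measurable (sigma \<Omega> M)" using m by measurable
    moreover have "finite (?s n ` \<Omega>)"
    proof (rule finite_subset)
      let ?c = "\<lceil>real (Suc n) * sup_norm f\<rceil>"
      show "?s n ` \<Omega> \<subseteq> (\<lambda>k. real_of_int k / real (Suc n)) ` {- ?c..?c}"
      proof (intro image_subsetI image_eqI[OF refl])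
        fix \<xi>
        have "\<bar>f \<xi>\<bar> \<le> sup_norm f" by (rule bounded_measurable_le_sup_norm[OF f])
        then have "f \<xi> \<le> sup_norm f" "- f \<xi> \<le> sup_norm f" by linarith+
        then have "real (Suc n) * f \<xi> \<le> real (Suc n) * sup_norm f"
          "real (Suc n) * (- f \<xi>) \<le> real (Suc n) * sup_norm f"
          by - (rule mult_left_mono, assumption, rule of_nat_0_le_iff)+
        then show "\<lfloor>real (Suc n) * f \<xi>\<rfloor> \<in> {- ?c..?c}" by (simp del: of_nat_Suc, linarith)
      qed
    qed simp
    ultimately have "simple_function (sigma \<Omega> M) (?s n)"
      by (simp add: simple_function_borel_measurable space_measure_of_conv)
    then show ?thesis using f by (simp add: simple_functions_def bounded_measurable_def)
  qed
  fix \<xi>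
  have "\<bar>real_of_int \<lfloor>real (Suc n) * f \<xi>\<rfloor> - real (Suc n) * f \<xi>\<bar> / real (Suc n) \<le> 1 / real (Suc n)"
    by (intro divide_right_mono) linarith+
  moreover have "?s n \<xi> - f \<xi> = (real_of_int \<lfloor>real (Suc n) * f \<xi>\<rfloor> - real (Suc n) * f \<xi>) / real (Suc n)"
    by (simp add: diff_divide_distrib del: of_nat_Suc)
  ultimately show "\<bar>?s n \<xi> - f \<xi>\<bar> \<le> 1 / real (Suc n)"
    by (simp add: abs_divide del: of_nat_Suc)
  assume "\<forall>\<xi>. 0 \<le> f \<xi>"
  then show "0 \<le> ?s n \<xi>" by simp
qed

text \<open>The limit case fixes the rate \<open>1 / Suc n\<close> that rounding delivers, so each
  later use has an explicit null sequence at hand; the price is that the rate must be restored after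
  multiplying by a function.\<close>

lemma bounded_measurable_induct [consumes 1, case_names indicator add scale limit]:
  assumes f: "f \<in> bounded_measurable \<Omega> M"
    and ind: "\<And>A. A \<in> M \<Longrightarrow> Q (indicator A)"
    and add: "\<And>f g. f \<in> bounded_measurable \<Omega> M \<Longrightarrow> Q f \<Longrightarrow> g \<in> bounded_measurable \<Omega> M \<Longrightarrow> Q g \<Longrightarrow>
      Q (\<lambda>\<xi>. f \<xi> + g \<xi>)"
    and scale: "\<And>c f. f \<in> bounded_measurable \<Omega> M \<Longrightarrow> Q f \<Longrightarrow> Q (\<lambda>\<xi>. c * f \<xi>)"
    and limit: "\<And>f s. f \<in> bounded_measurable \<Omega> M \<Longrightarrow> (\<And>n. s n \<in> bounded_measurable \<Omega> M) \<Longrightarrow>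
      (\<And>n. Q (s n)) \<Longrightarrow> (\<And>n \<xi>. \<bar>s n \<xi> - f \<xi>\<bar> \<le> 1 / real (Suc n)) \<Longrightarrow> Q f"
  shows "Q f"
proof -
  have simple: "Q g" if g: "g \<in> simple_functions \<Omega> M" for g
  proof -
    \<comment> \<open>Membership is carried along with \<open>Q\<close>, because the addition rule
      asks for both. The empty sum is treated as 0 times the indicator of the empty set.\<close>
    have "(\<lambda>\<xi>. \<Sum>v\<in>V. v * indicator (g -` {v} \<inter> \<Omega>) \<xi>) \<in> bounded_measurable \<Omega> M \<and>
        Q (\<lambda>\<xi>. \<Sum>v\<in>V. v * indicator (g -` {v} \<inter> \<Omega>) \<xi>)"
      if "finite V" "V \<subseteq> g ` \<Omega>" for V
      using that
    proof (induction V rule: finite_induct)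
      case empty
      show ?case
        using scale[OF indicator_bounded_measurable ind, of "{}" 0]
          bounded_measurable_scale[OF indicator_bounded_measurable, of "{}" 0] by simp
    next
      case (insert v V)
      have "g -` {v} \<inter> \<Omega> \<in> M"
        using g insert.prems by (auto simp: simple_functions_def simple_function_sigma_iff)
      note v = indicator_bounded_measurable[OF this] ind[OF this]
      have "(\<lambda>\<xi>. \<Sum>v\<in>insert v V. v * indicator (g -` {v} \<inter> \<Omega>) \<xi>) =
          (\<lambda>\<xi>. v * indicator (g -` {v} \<inter> \<Omega>) \<xi> + (\<Sum>v\<in>V. v * indicator (g -` {v} \<inter> \<Omega>) \<xi>))"
        by (rule ext, rule sum.insert) fact+
      moreover have "V \<subseteq> g ` \<Omega>" using insert.prems by simp
      ultimately show ?case
        using insert.IH v by (simp only: add bounded_measurable_add scale bounded_measurable_scale)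
    qed
    note sums = this
    have "finite (g ` \<Omega>)"
      using g by (auto simp: simple_functions_def simple_function_sigma_iff)
    from sums[OF this order_refl] show ?thesis
      by (subst simple_functions_canonical[OF g]) (rule conjunct2)
  qed
  obtain s where "\<And>n. s n \<in> simple_functions \<Omega> M" "\<And>n \<xi>. \<bar>s n \<xi> - f \<xi>\<bar> \<le> 1 / real (Suc n)"
    using bounded_measurable_approx[OF f] by blast
  then show ?thesis
    using simple simple_subset_bounded_measurable by (intro limit[OF f]) blast+
qed

end

section \<open>The integral with respect to a positive spectral measure\<close>

locale positive_spectral = sigma_algebra X \<Omega> for X :: "'a set" and \<Omega> +
  fixes P :: "'a set \<Rightarrow> 'e::banach_lattice \<Rightarrow>\<^sub>L 'e"
  assumes spectral: "positive_spectral_measure \<Omega> P"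
begin

lemma P_positive: "A \<in> \<Omega> \<Longrightarrow> positive_op (P A)"
  and P_empty: "P {} = 0"
  and P_Int: "A \<in> \<Omega> \<Longrightarrow> C \<in> \<Omega> \<Longrightarrow> P (A \<inter> C) = P A o\<^sub>L P C"
  and P_sums: "range D \<subseteq> \<Omega> \<Longrightarrow> disjoint_family D \<Longrightarrow>
    (\<lambda>n. blinfun_apply (P (D n)) x) sums blinfun_apply (P (\<Union>n. D n)) x"
  using spectral unfolding positive_spectral_measure_def by blast+

text \<open>Additivity over \<open>A\<close> and its complement identifies the difference as
  \<open>P (X - A)\<close>.\<close>

lemma P_le:
  assumes A: "A \<in> \<Omega>"
  shows "positive_op (P X - P A)"
proof -
  have "range (binaryset A (X - A)) \<subseteq> \<Omega>" "disjoint_family (binaryset A (X - A))"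
    using A by (auto simp: range_binaryset_eq disjoint_family_on_def binaryset_def)
  from P_sums[OF this] have "(\<lambda>n. blinfun_apply (P (binaryset A (X - A) n)) x) sums blinfun_apply (P X) x" for x
    using A sets_into_space[of A] by (simp add: UN_binaryset_eq Un_absorb1)
  moreover have "(\<lambda>n. blinfun_apply (P (binaryset A (X - A) n)) x) sums
      (blinfun_apply (P A) x + blinfun_apply (P (X - A)) x)" for x
    using binaryset_sums[of "\<lambda>C. blinfun_apply (P C) x" A "X - A"] by (simp add: P_empty)
  ultimately have "blinfun_apply (P X) x = blinfun_apply (P A) x + blinfun_apply (P (X - A)) x" for x
    by (rule sums_unique2)
  then have "P X - P A = P (X - A)"
    by (intro blinfun_eqI) (simp add: blinfun.diff_left)
  then show ?thesis using A by (simp add: P_positive compl_sets)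
qed

lemma norm_P_le: "A \<in> \<Omega> \<Longrightarrow> norm (P A) \<le> norm (P X)"
  by (intro norm_blinfun_le_dominated P_le positive_op_add P_positive) auto

lemma scalar_measure:
  "bounded_signed_measure X \<Omega> (spectral_scalar_measure P x x') (norm x' * (norm (P X) * norm x))"
proof unfold_locales
  show "spectral_scalar_measure P x x' {} = 0"
    by (simp add: spectral_scalar_measure_def P_empty)
  show "(\<lambda>n. spectral_scalar_measure P x x' (D n)) sums spectral_scalar_measure P x x' (\<Union>n. D n)"
    if "range D \<subseteq> \<Omega>" "disjoint_family D" for D :: "nat \<Rightarrow> 'a set"
    unfolding spectral_scalar_measure_def
    by (rule bounded_linear.sums[OF blinfun.bounded_linear_right P_sums[OF that]])
  fix A assume "A \<in> \<Omega>"
  have "\<bar>blinfun_apply x' (blinfun_apply (P A) x)\<bar> \<le> norm x' * norm (blinfun_apply (P A) x)"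
    using norm_blinfun[of x' "blinfun_apply (P A) x"] by simp
  also have "\<dots> \<le> norm x' * (norm (P X) * norm x)"
    using norm_blinfun[of "P A" x] mult_right_mono[OF norm_P_le[OF \<open>A \<in> \<Omega>\<close>] norm_ge_zero[of x]]
    by (intro mult_left_mono) (rule order.trans, assumption+, rule norm_ge_zero)
  finally show "\<bar>spectral_scalar_measure P x x' A\<bar> \<le> norm x' * (norm (P X) * norm x)"
    by (simp add: spectral_scalar_measure_def)
qed

text \<open>A relation rather than a function, since existence of \<open>T\<close> is at first
  available for simple \<open>f\<close> only, while uniqueness holds from the start.\<close>

definition represents :: "('e \<Rightarrow>\<^sub>L 'e) \<Rightarrow> ('a \<Rightarrow> real) \<Rightarrow> bool" where
  "represents T f \<longleftrightarrow> (\<forall>x x'. blinfun_apply x' (blinfun_apply T x) =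
     signed_integral X \<Omega> (spectral_scalar_measure P x x') f)"

lemma represents_unique: "represents S f \<Longrightarrow> represents T f \<Longrightarrow> S = T"
  unfolding represents_def by (rule blinfun_eq_if_weakly_eq) simp

lemma represents_indicator: "A \<in> \<Omega> \<Longrightarrow> represents (P A) (indicator A)"
  by (simp add: represents_def spectral_scalar_measure_def
      bounded_signed_measure.signed_integral_indicator[OF scalar_measure])

lemma represents_add:
  "represents S f \<Longrightarrow> represents T g \<Longrightarrow> f \<in> bounded_measurable X \<Omega> \<Longrightarrow> g \<in> bounded_measurable X \<Omega> \<Longrightarrow>
    represents (S + T) (\<lambda>\<xi>. f \<xi> + g \<xi>)"
  by (simp add: represents_def blinfun.bilinear_simps
      bounded_signed_measure.signed_integral_add[OF scalar_measure])

lemma represents_scale: "represents T f \<Longrightarrow> represents (c *\<^sub>R T) (\<lambda>\<xi>. c * f \<xi>)"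
  by (simp add: represents_def blinfun.bilinear_simps
      bounded_signed_measure.signed_integral_scale[OF scalar_measure])

lemma represents_diff:
  assumes "represents S f" "represents T g" "f \<in> bounded_measurable X \<Omega>" "g \<in> bounded_measurable X \<Omega>"
  shows "represents (S - T) (\<lambda>\<xi>. f \<xi> - g \<xi>)"
  using represents_add[OF assms(1) represents_scale[OF assms(2), of "- 1"] assms(3)
      bounded_measurable_scale[OF assms(4)]] by simp

lemma represents_limit:
  assumes T: "\<And>n. represents (T n) (s n)" and TS: "T \<longlonglongrightarrow> S"
    and f: "f \<in> bounded_measurable X \<Omega>" and s: "\<And>n. s n \<in> bounded_measurable X \<Omega>"
    and close: "\<And>n \<xi>. \<bar>s n \<xi> - f \<xi>\<bar> \<le> 1 / real (Suc n)"
  shows "represents S f"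
  unfolding represents_def
proof (intro allI)
  fix x and x' :: "'e \<Rightarrow>\<^sub>L real"
  have "(\<lambda>n. signed_integral X \<Omega> (spectral_scalar_measure P x x') (s n)) \<longlonglongrightarrow>
      signed_integral X \<Omega> (spectral_scalar_measure P x x') f"
  proof (rule bounded_signed_measure.signed_integral_dominated_convergence[OF scalar_measure f s])
    show "(\<lambda>n. s n \<xi>) \<longlonglongrightarrow> f \<xi>" for \<xi>
    proof (rule LIM_zero_cancel, rule Lim_null_comparison)
      show "\<forall>\<^sub>F n in sequentially. norm (s n \<xi> - f \<xi>) \<le> 1 / real (Suc n)"
        using close by (intro always_eventually allI) (simp only: real_norm_def)
      show "(\<lambda>n. 1 / real (Suc n)) \<longlonglongrightarrow> 0"
        using LIMSEQ_inverse_real_of_nat by (simp only: inverse_eq_divide)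
    qed
    \<comment> \<open>The error is at most \<open>1 / Suc n \<le> 1\<close>, which gives a constant
      dominating function.\<close>
    show "\<bar>s n \<xi>\<bar> \<le> sup_norm f + 1" for n \<xi>
    proof -
      have "1 / real (Suc n) \<le> 1" by simp
      then show ?thesis
        using close[of n \<xi>] bounded_measurable_le_sup_norm[OF f, of \<xi>] by linarith
    qed
  qed
  then have "(\<lambda>n. blinfun_apply x' (blinfun_apply (T n) x)) \<longlonglongrightarrow>
      signed_integral X \<Omega> (spectral_scalar_measure P x x') f"
    using T by (simp add: represents_def)
  moreover have "(\<lambda>n. blinfun_apply x' (blinfun_apply (T n) x)) \<longlonglongrightarrow> blinfun_apply x' (blinfun_apply S x)"
    by (intro blinfun.tendsto tendsto_const TS)
  ultimately show "blinfun_apply x' (blinfun_apply S x) =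
      signed_integral X \<Omega> (spectral_scalar_measure P x x') f"
    by (rule LIMSEQ_unique[rotated])
qed

lemma represents_simple:
  assumes f: "f \<in> simple_functions X \<Omega>"
  shows "\<exists>T. represents T f \<and> ((\<forall>\<xi>. 0 \<le> f \<xi>) \<longrightarrow> positive_op T)"
proof -
  define T where "T = (\<Sum>v\<in>f ` X. v *\<^sub>R P (f -` {v} \<inter> X))"
  have fin: "finite (f ` X)" and meas: "\<And>v. v \<in> f ` X \<Longrightarrow> f -` {v} \<inter> X \<in> \<Omega>"
    using f by (auto simp: simple_functions_def simple_function_sigma_iff)
  have "(\<lambda>\<xi>. \<Sum>v\<in>V. v * indicator (f -` {v} \<inter> X) \<xi>) \<in> bounded_measurable X \<Omega> \<and>
      represents (\<Sum>v\<in>V. v *\<^sub>R P (f -` {v} \<inter> X)) (\<lambda>\<xi>. \<Sum>v\<in>V. v * indicator (f -` {v} \<inter> X) \<xi>)"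
    if "finite V" "V \<subseteq> f ` X" for V
    using that
  proof (induction V rule: finite_induct)
    case empty
    show ?case
      using represents_scale[OF represents_indicator, of "{}" 0]
        bounded_measurable_scale[OF indicator_bounded_measurable, of "{}" 0] by simp
  next
    case (insert v V)
    have "f -` {v} \<inter> X \<in> \<Omega>" using insert.prems by (intro meas) simp
    note v = indicator_bounded_measurable[OF this] represents_indicator[OF this]
    have "V \<subseteq> f ` X" using insert.prems by simp
    then show ?case
      using insert.IH v unfolding sum.insert[OF insert.hyps]
      by (simp only: represents_add bounded_measurable_add represents_scale bounded_measurable_scale)
  qed
  from conjunct2[OF this[OF fin order_refl]] have "represents T f"
    unfolding T_def simple_functions_canonical[OF f, symmetric] .
  moreover have "positive_op T" if "\<forall>\<xi>. 0 \<le> f \<xi>"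
    unfolding T_def using that by (intro positive_op_sum positive_op_scaleR P_positive meas) auto
  ultimately show ?thesis by blast
qed

text \<open>Where some operator represents \<open>f\<close>, uniqueness makes the choice immaterial;
  for other \<open>f\<close> the value is arbitrary.\<close>

definition spectral_integral :: "('a \<Rightarrow> real) \<Rightarrow> 'e \<Rightarrow>\<^sub>L 'e" where
  "spectral_integral f = (SOME T. represents T f)"

lemma spectral_integral_eq: "represents T f \<Longrightarrow> spectral_integral f = T"
  unfolding spectral_integral_def by (rule some_equality) (auto intro: represents_unique)

text \<open>Both \<open>c * indicator X - f\<close> and \<open>c * indicator X + f\<close> are
  simple and nonnegative, hence have positive representing operators; by uniqueness these are
  \<open>c *\<^sub>R P X - T\<close> and \<open>c *\<^sub>R P X + T\<close>.\<close>

lemma represents_bound_simple: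
  assumes f: "f \<in> simple_functions X \<Omega>" and T: "represents T f" and c: "\<And>\<xi>. \<bar>f \<xi>\<bar> \<le> c"
  shows "norm T \<le> c * norm (P X)"
proof -
  have c0: "0 \<le> c" using c order.trans abs_ge_zero by blast
  have X: "indicator X \<in> simple_functions X \<Omega>" "indicator X \<in> bounded_measurable X \<Omega>"
    by (auto intro: indicator_simple indicator_bounded_measurable)
  have cX: "(\<lambda>\<xi>. c * indicator X \<xi>) \<in> simple_functions X \<Omega>"
    by (rule simple_functions_scale[OF X(1)])
  have rX: "represents (c *\<^sub>R P X) (\<lambda>\<xi>. c * indicator X \<xi>)"
    by (rule represents_scale[OF represents_indicator]) simp
  have pos: "positive_op (c *\<^sub>R P X - S)"
    if g: "g \<in> simple_functions X \<Omega>" "represents S g" "\<And>\<xi>. \<bar>g \<xi>\<bar> \<le> c" for g S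
  proof -
    have "represents (c *\<^sub>R P X - S) (\<lambda>\<xi>. c * indicator X \<xi> - g \<xi>)"
      using cX g simple_subset_bounded_measurable by (intro represents_diff rX) auto
    moreover obtain R where R: "represents R (\<lambda>\<xi>. c * indicator X \<xi> - g \<xi>)"
      "(\<forall>\<xi>. 0 \<le> c * indicator X \<xi> - g \<xi>) \<longrightarrow> positive_op R"
      using represents_simple[OF simple_functions_diff[OF cX g(1)]] by blast
    moreover have "0 \<le> c * indicator X \<xi> - g \<xi>" for \<xi>
    proof (cases "\<xi> \<in> X")
      case True
      then show ?thesis using g(3)[of \<xi>] by simp
    next
      case False
      then show ?thesis using g(1) by (simp add: simple_functions_def)
    qed
    ultimately show ?thesis using represents_unique by blast
  qed
  have "positive_op (c *\<^sub>R P X - T)" by (rule pos[OF f T c])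
  moreover have "positive_op (c *\<^sub>R P X + T)"
    \<comment> \<open>The plus sign is the previous claim applied to \<open>- f\<close> and
      \<open>- T\<close>.\<close>
    using pos[OF simple_functions_scale[OF f, of "- 1"] represents_scale[OF T, of "- 1"]] c by simp
  ultimately have "norm T \<le> norm (c *\<^sub>R P X)" by (rule norm_blinfun_le_dominated)
  with c0 show ?thesis by simp
qed

text \<open>The simple approximants differ by at most \<open>1 / Suc m + 1 / Suc n\<close>, so their
  operators form a Cauchy sequence. Positivity survives because approximants of a nonnegative
  function are nonnegative and positive operators are closed under norm limits.\<close>

lemma represents_exists:
  assumes f: "f \<in> bounded_measurable X \<Omega>"
  shows "\<exists>T. represents T f \<and> ((\<forall>\<xi>. 0 \<le> f \<xi>) \<longrightarrow> positive_op T)"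
proof -
  obtain s where s: "\<And>n. s n \<in> simple_functions X \<Omega>" "\<And>n \<xi>. \<bar>s n \<xi> - f \<xi>\<bar> \<le> 1 / real (Suc n)"
    "(\<forall>\<xi>. 0 \<le> f \<xi>) \<Longrightarrow> (\<forall>n \<xi>. 0 \<le> s n \<xi>)"
    using bounded_measurable_approx[OF f] by blast
  have s_bm: "s n \<in> bounded_measurable X \<Omega>" for n
    using s(1) simple_subset_bounded_measurable by blast
  obtain T where T: "\<And>n. represents (T n) (s n)" "\<And>n. (\<forall>\<xi>. 0 \<le> s n \<xi>) \<longrightarrow> positive_op (T n)"
    using represents_simple[OF s(1)] by metis
  have "norm (T m - T n) \<le> (1 / real (Suc m) + 1 / real (Suc n)) * norm (P X)" for m n
  proof (rule represents_bound_simple)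
    show "represents (T m - T n) (\<lambda>\<xi>. s m \<xi> - s n \<xi>)"
      by (intro represents_diff T s_bm)
    show "\<bar>s m \<xi> - s n \<xi>\<bar> \<le> 1 / real (Suc m) + 1 / real (Suc n)" for \<xi>
      using s(2)[of m \<xi>] s(2)[of n \<xi>] by linarith
  qed (intro simple_functions_diff s)
  then have bound: "norm (T m - T n) \<le> 2 / real (Suc N) * norm (P X)" if "m \<ge> N" "n \<ge> N" for m n N
  proof -
    have "1 / real (Suc m) + 1 / real (Suc n) \<le> 1 / real (Suc N) + 1 / real (Suc N)"
      using that by (intro add_mono divide_left_mono) auto
    then have "(1 / real (Suc m) + 1 / real (Suc n)) * norm (P X) \<le> 2 / real (Suc N) * norm (P X)"
      by (intro mult_right_mono) auto
    with \<open>norm (T m - T n) \<le> (1 / real (Suc m) + 1 / real (Suc n)) * norm (P X)\<close> show ?thesis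
      by (rule order.trans)
  qed
  have "Cauchy T"
  proof (rule CauchyI)
    fix e :: real assume e: "0 < e"
    have "(\<lambda>N. 2 * (1 / real (Suc N)) * norm (P X)) \<longlonglongrightarrow> 2 * 0 * norm (P X)"
      using LIMSEQ_inverse_real_of_nat by (intro tendsto_intros) (simp only: inverse_eq_divide)
    then have "\<forall>\<^sub>F N in sequentially. 2 * (1 / real (Suc N)) * norm (P X) < e"
      using e by (intro order_tendstoD(2)) auto
    then obtain N where "2 * (1 / real (Suc N)) * norm (P X) < e"
      unfolding eventually_sequentially by blast
    then have "2 / real (Suc N) * norm (P X) < e" by simp
    then show "\<exists>N. \<forall>m\<ge>N. \<forall>n\<ge>N. norm (T m - T n) < e"
      using bound by (meson le_less_trans)
  qed
  then obtain S where S: "T \<longlonglongrightarrow> S"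
    using Cauchy_convergent convergent_def by blast
  have "represents S f"
    by (rule represents_limit[OF T(1) S f s_bm s(2)])
  moreover have "positive_op S" if "\<forall>\<xi>. 0 \<le> f \<xi>"
    using s(3)[OF that] T(2) by (intro positive_op_limit[OF S]) blast
  ultimately show ?thesis by blast
qed

lemma represents_spectral_integral:
  "f \<in> bounded_measurable X \<Omega> \<Longrightarrow> represents (spectral_integral f) f"
  using represents_exists spectral_integral_eq by blast

lemma spectral_integral_positive:
  "f \<in> bounded_measurable X \<Omega> \<Longrightarrow> (\<And>\<xi>. 0 \<le> f \<xi>) \<Longrightarrow> positive_op (spectral_integral f)"
  using represents_exists spectral_integral_eq by blast

lemma spectral_integral_indicator: "A \<in> \<Omega> \<Longrightarrow> spectral_integral (indicator A) = P A"
  by (intro spectral_integral_eq represents_indicator)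

lemma spectral_integral_add:
  "f \<in> bounded_measurable X \<Omega> \<Longrightarrow> g \<in> bounded_measurable X \<Omega> \<Longrightarrow>
    spectral_integral (\<lambda>\<xi>. f \<xi> + g \<xi>) = spectral_integral f + spectral_integral g"
  by (intro spectral_integral_eq represents_add represents_spectral_integral)

lemma spectral_integral_diff:
  "f \<in> bounded_measurable X \<Omega> \<Longrightarrow> g \<in> bounded_measurable X \<Omega> \<Longrightarrow>
    spectral_integral (\<lambda>\<xi>. f \<xi> - g \<xi>) = spectral_integral f - spectral_integral g"
  by (intro spectral_integral_eq represents_diff represents_spectral_integral)

lemma spectral_integral_scale:
  "f \<in> bounded_measurable X \<Omega> \<Longrightarrow> spectral_integral (\<lambda>\<xi>. c * f \<xi>) = c *\<^sub>R spectral_integral f"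
  by (intro spectral_integral_eq represents_scale represents_spectral_integral)

text \<open>The argument for simple functions, repeated now that positivity is known for all
  nonnegative bounded measurable functions. The order form yields regularity and both norm
  bounds.\<close>

lemma spectral_integral_dominated:
  assumes f: "f \<in> bounded_measurable X \<Omega>" and c: "\<And>\<xi>. \<bar>f \<xi>\<bar> \<le> c"
  shows "positive_op (c *\<^sub>R P X - spectral_integral f)" "positive_op (c *\<^sub>R P X + spectral_integral f)"
proof -
  have X: "indicator X \<in> bounded_measurable X \<Omega>" by (rule indicator_bounded_measurable) simp
  have cX: "(\<lambda>\<xi>. c * indicator X \<xi>) \<in> bounded_measurable X \<Omega>"
    by (rule bounded_measurable_scale[OF X])
  have eq: "c *\<^sub>R P X = spectral_integral (\<lambda>\<xi>. c * indicator X \<xi>)"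
    using spectral_integral_scale[OF X] by (simp add: spectral_integral_indicator)
  have nonneg: "0 \<le> c * indicator X \<xi> - f \<xi>" "0 \<le> c * indicator X \<xi> + f \<xi>" for \<xi>
    using c[of \<xi>] f by (cases "\<xi> \<in> X"; simp add: bounded_measurable_def; linarith)+
  show "positive_op (c *\<^sub>R P X - spectral_integral f)"
    unfolding eq spectral_integral_diff[OF cX f, symmetric]
    by (intro spectral_integral_positive bounded_measurable_diff cX f nonneg)
  show "positive_op (c *\<^sub>R P X + spectral_integral f)"
    unfolding eq spectral_integral_add[OF cX f, symmetric]
    by (intro spectral_integral_positive bounded_measurable_add cX f nonneg)
qed

lemma spectral_integral_norm_le:
  assumes f: "f \<in> bounded_measurable X \<Omega>" and c: "\<And>\<xi>. \<bar>f \<xi>\<bar> \<le> c"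
  shows "norm (spectral_integral f) \<le> c * norm (P X)"
proof -
  have "0 \<le> c" using c order.trans abs_ge_zero by blast
  then show ?thesis
    using norm_blinfun_le_dominated[OF spectral_integral_dominated[OF f c]] by simp
qed

text \<open>With \<open>c = sup_norm f\<close>, the operator is the difference of the positive
  operators \<open>c *\<^sub>R P X\<close> and
  \<open>c *\<^sub>R P X - spectral_integral f\<close>.\<close>

lemma spectral_integral_regular:
  assumes f: "f \<in> bounded_measurable X \<Omega>"
  shows "spectral_integral f \<in> regular_ops"
proof -
  note dom = spectral_integral_dominated[OF f bounded_measurable_le_sup_norm[OF f]]
  have "sup_norm f *\<^sub>R P X - (sup_norm f *\<^sub>R P X - spectral_integral f) \<in> regular_ops"
    using positive_op_if_dominating[OF dom] dom(1) by (intro regular_ops_diff positive_op_regular)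
  then show ?thesis by simp
qed

lemma spectral_integral_regular_norm_le:
  assumes dc: "dedekind_complete TYPE('e)"
    and f: "f \<in> bounded_measurable X \<Omega>" and c: "\<And>\<xi>. \<bar>f \<xi>\<bar> \<le> c"
  shows "regular_norm (spectral_integral f) \<le> c * norm (P X)"
proof -
  have "0 \<le> c" using c order.trans abs_ge_zero by blast
  then show ?thesis
    using regular_norm_le[OF dc spectral_integral_regular[OF f] spectral_integral_dominated[OF f c]] by simp
qed

section \<open>Norm limits and multiplicativity of the integral\<close>

lemma null_sequence_norm_P: "(\<lambda>n. 1 / real (Suc n) * norm (P X)) \<longlonglongrightarrow> 0"
  by (rule tendsto_mult_left_zero) (use LIMSEQ_inverse_real_of_nat in \<open>simp only: inverse_eq_divide\<close>)

lemma spectral_integral_limit: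
  assumes f: "f \<in> bounded_measurable X \<Omega>" and s: "\<And>n. s n \<in> bounded_measurable X \<Omega>"
    and close: "\<And>n \<xi>. \<bar>s n \<xi> - f \<xi>\<bar> \<le> 1 / real (Suc n)"
  shows "(\<lambda>n. spectral_integral (s n)) \<longlonglongrightarrow> spectral_integral f"
proof -
  have "norm (spectral_integral (s n) - spectral_integral f) \<le> 1 / real (Suc n) * norm (P X)" for n
    unfolding spectral_integral_diff[OF s f, symmetric]
    by (intro spectral_integral_norm_le bounded_measurable_diff s f close)
  then have "(\<lambda>n. spectral_integral (s n) - spectral_integral f) \<longlonglongrightarrow> 0"
    by (intro Lim_null_comparison[OF _ null_sequence_norm_P] always_eventually allI)
  then show ?thesis by (rule LIM_zero_cancel)
qed

interpretation blinfun_compose: bounded_bilinear "(o\<^sub>L)"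
  by (rule bounded_bilinear_blinfun_compose)

text \<open>First pass of multiplicativity: one factor is frozen as an indicator and the other
  varies. The base case is the intersection law of \<open>P\<close>, and this result is in turn the
  base case for a general second factor.\<close>

lemma spectral_integral_mult_indicator:
  assumes A: "A \<in> \<Omega>" and f: "f \<in> bounded_measurable X \<Omega>"
  shows "spectral_integral (\<lambda>\<xi>. f \<xi> * indicator A \<xi>) = spectral_integral f o\<^sub>L P A"
  using f
proof (induction rule: bounded_measurable_induct)
  case (indicator C)
  have "(\<lambda>\<xi>. indicator C \<xi> * indicator A \<xi> :: real) = indicator (C \<inter> A)"
    by (simp add: fun_eq_iff indicator_inter_arith)
  then show ?case
    using A indicator by (simp add: spectral_integral_indicator Int P_Int)
next
  case (add f g)
  then show ?case
    using A by (simp add: distrib_right spectral_integral_add bounded_measurable_mult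
        indicator_bounded_measurable blinfun_compose.add_left)
next
  case (scale c f)
  then show ?case
    using A by (simp add: mult.assoc spectral_integral_scale bounded_measurable_mult
        indicator_bounded_measurable blinfun_compose.scaleR_left)
next
  case (limit f s)
  have iA: "indicator A \<in> bounded_measurable X \<Omega>" by (rule indicator_bounded_measurable[OF A])
  have "(\<lambda>n. spectral_integral (\<lambda>\<xi>. s n \<xi> * indicator A \<xi>)) \<longlonglongrightarrow> spectral_integral (\<lambda>\<xi>. f \<xi> * indicator A \<xi>)"
  proof (rule spectral_integral_limit)
    \<comment> \<open>An indicator is at most 1, so the approximation rate is preserved.\<close>
    show "\<bar>s n \<xi> * indicator A \<xi> - f \<xi> * indicator A \<xi>\<bar> \<le> 1 / real (Suc n)" for n \<xi>
      using limit.hyps(3)[of n \<xi>] by (simp add: indicator_def)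
  qed (intro bounded_measurable_mult limit iA)+
  moreover have "(\<lambda>n. spectral_integral (s n) o\<^sub>L P A) \<longlonglongrightarrow> (spectral_integral f o\<^sub>L P A)"
    by (intro blinfun_compose.tendsto tendsto_const spectral_integral_limit limit)
  ultimately show ?case
    unfolding limit.IH by (rule LIMSEQ_unique)
qed

lemma spectral_integral_mult:
  assumes f: "f \<in> bounded_measurable X \<Omega>" and g: "g \<in> bounded_measurable X \<Omega>"
  shows "spectral_integral (\<lambda>\<xi>. f \<xi> * g \<xi>) = spectral_integral f o\<^sub>L spectral_integral g"
  using g
proof (induction rule: bounded_measurable_induct)
  case (indicator A)
  then show ?case
    using f by (simp add: spectral_integral_mult_indicator spectral_integral_indicator)
next
  case (add g h)
  then show ?case
    using f by (simp add: distrib_left spectral_integral_add bounded_measurable_mult blinfun_compose.add_right)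
next
  case (scale c g)
  then show ?case
    using f by (simp add: mult.left_commute spectral_integral_scale bounded_measurable_mult
        blinfun_compose.scaleR_right)
next
  case (limit g s)
  \<comment> \<open>Multiplication by \<open>f\<close> would spoil the rate
    \<open>1 / Suc n\<close>. Dividing by \<open>C\<close> makes the factor at most 1 in absolute
    value, and the added 1 keeps \<open>C\<close> positive when \<open>f\<close> is zero.\<close>
  define C where "C = sup_norm f + 1"
  have C: "\<bar>f \<xi>\<bar> \<le> C" "0 < C" for \<xi>
    using bounded_measurable_le_sup_norm[OF f, of \<xi>] by (simp_all add: C_def)
  have bm: "(\<lambda>\<xi>. f \<xi> / C * h \<xi>) \<in> bounded_measurable X \<Omega>" if "h \<in> bounded_measurable X \<Omega>" for h
    using bounded_measurable_mult[OF bounded_measurable_scale[OF f, of "1 / C"] that] by simp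
  have eq: "spectral_integral (\<lambda>\<xi>. f \<xi> / C * h \<xi>) = (1 / C) *\<^sub>R spectral_integral (\<lambda>\<xi>. f \<xi> * h \<xi>)"
    if "h \<in> bounded_measurable X \<Omega>" for h
    using spectral_integral_scale[OF bounded_measurable_mult[OF f that], of "1 / C"] by simp
  have "(\<lambda>n. spectral_integral (\<lambda>\<xi>. f \<xi> / C * s n \<xi>)) \<longlonglongrightarrow> spectral_integral (\<lambda>\<xi>. f \<xi> / C * g \<xi>)"
  proof (rule spectral_integral_limit)
    show "\<bar>f \<xi> / C * s n \<xi> - f \<xi> / C * g \<xi>\<bar> \<le> 1 / real (Suc n)" for n \<xi>
    proof -
      have "\<bar>f \<xi> / C * s n \<xi> - f \<xi> / C * g \<xi>\<bar> = \<bar>f \<xi>\<bar> / C * \<bar>s n \<xi> - g \<xi>\<bar>"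
        using C(2) unfolding right_diff_distrib[symmetric] abs_mult abs_divide by simp
      also have "\<dots> \<le> 1 * (1 / real (Suc n))"
        using C by (intro mult_mono limit.hyps(3)) auto
      finally show ?thesis by simp
    qed
  qed (intro bm limit)+
  from tendsto_scaleR[OF tendsto_const[of C] this]
  have "(\<lambda>n. spectral_integral (\<lambda>\<xi>. f \<xi> * s n \<xi>)) \<longlonglongrightarrow> spectral_integral (\<lambda>\<xi>. f \<xi> * g \<xi>)"
    unfolding eq[OF limit.hyps(1)] eq[OF limit.hyps(2)] using C(2) by simp
  moreover have "(\<lambda>n. spectral_integral f o\<^sub>L spectral_integral (s n)) \<longlonglongrightarrow> (spectral_integral f o\<^sub>L spectral_integral g)"
    by (intro blinfun_compose.tendsto tendsto_const spectral_integral_limit limit)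
  ultimately show ?case
    unfolding limit.IH by (rule LIMSEQ_unique)
qed

end

section \<open>Generated subalgebras, commutants and weak limits\<close>

text \<open>The topology is pulled back from real functions on pairs \<open>(x, x')\<close>, whose
  euclidean topology is the product topology; convergence there is convergence at each pair.\<close>

lemma limitin_weak_operator_topology:
  fixes T :: "nat \<Rightarrow> 'a::real_normed_vector \<Rightarrow>\<^sub>L 'b::real_normed_vector"
  assumes "\<And>x (x' :: 'b \<Rightarrow>\<^sub>L real). (\<lambda>n. blinfun_apply x' (blinfun_apply (T n) x)) \<longlonglongrightarrow> blinfun_apply x' (blinfun_apply S x)"
  shows "limitin weak_operator_topology T S sequentially"
proof -
  define h :: "('a \<Rightarrow>\<^sub>L 'b) \<Rightarrow> 'a \<times> ('b \<Rightarrow>\<^sub>L real) \<Rightarrow> real"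
    where "h T = (\<lambda>(x, x'). blinfun_apply x' (blinfun_apply T x))" for T
  have "limitin (product_topology (\<lambda>_. euclidean) UNIV) (\<lambda>n. h (T n)) (h S) sequentially"
    unfolding limitin_componentwise by (auto simp: h_def intro!: assms)
  then have lim: "(\<lambda>n. h (T n)) \<longlonglongrightarrow> h S"
    by (simp add: euclidean_product_topology)
  show ?thesis
    unfolding limitin_def weak_operator_topology_def topspace_pullback_topology openin_pullback_topology
      h_def[symmetric]
  proof (intro conjI allI impI)
    fix U assume "(\<exists>V. openin euclidean V \<and> U = h -` V \<inter> UNIV) \<and> S \<in> U"
    then obtain V where V: "open V" "U = h -` V" "h S \<in> V" by auto
    show "\<forall>\<^sub>F n in sequentially. T n \<in> U"
      using topological_tendstoD[OF lim V(1,3)] by (simp add: V(2))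
  qed simp
qed

text \<open>A hull is the intersection of the admissible sets above its generators, so it is
  determined by which admissible sets contain them.\<close>

lemma hull_eqI: "(\<And>t. S t \<Longrightarrow> A \<subseteq> t \<longleftrightarrow> B \<subseteq> t) \<Longrightarrow> S hull A = S hull B"
  unfolding hull_def by (rule arg_cong[where f = Inter]) blast

lemma closed_op_subalgebra_centralizer: "closed_op_subalgebra {S. T o\<^sub>L S = S o\<^sub>L T}"
proof -
  interpret blinfun_compose: bounded_bilinear "(o\<^sub>L)"
    by (rule bounded_bilinear_blinfun_compose)
  have "closed {S. T o\<^sub>L S = S o\<^sub>L T}"
    by (intro closed_Collect_eq blinfun_compose.continuous_on continuous_on_const continuous_on_id)
  moreover have "R o\<^sub>L S o\<^sub>L T = T o\<^sub>L (R o\<^sub>L S)"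
    if "T o\<^sub>L R = R o\<^sub>L T" "T o\<^sub>L S = S o\<^sub>L T" for R S
  proof (rule blinfun_eqI)
    have "blinfun_apply (T o\<^sub>L R) y = blinfun_apply (R o\<^sub>L T) y"
      "blinfun_apply (T o\<^sub>L S) y = blinfun_apply (S o\<^sub>L T) y" for y
      by (simp_all only: that)
    then show "blinfun_apply (R o\<^sub>L S o\<^sub>L T) x = blinfun_apply (T o\<^sub>L (R o\<^sub>L S)) x" for x
      by simp
  qed
  ultimately show ?thesis
    unfolding closed_op_subalgebra_def op_subalgebra_def subspace_def
    by (simp add: blinfun_compose.add_left blinfun_compose.add_right
        blinfun_compose.scaleR_left blinfun_compose.scaleR_right)
qed

text \<open>\<open>T\<close> commutes with all of \<open>D\<close> exactly when \<open>D\<close>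
  lies in the centralizer of \<open>T\<close>, which is a closed subalgebra. So the criterion for
  equal generated subalgebras also decides equality of commutants.\<close>

lemma commutant_eqI:
  assumes "\<And>C. closed_op_subalgebra C \<Longrightarrow> A \<subseteq> C \<longleftrightarrow> B \<subseteq> C"
  shows "commutant A = commutant B"
proof -
  have "commutant D = {T. D \<subseteq> {S. T o\<^sub>L S = S o\<^sub>L T}}" for D :: "('a \<Rightarrow>\<^sub>L 'a) set"
    by (auto simp: commutant_def)
  then show ?thesis
    using assms[OF closed_op_subalgebra_centralizer] by simp
qed

text \<open>The regular norm dominates the operator norm, so convergence in it stays inside
  \<open>C\<close>. This is what compares the two kinds of generated subalgebras.\<close>

lemma closed_regular_subalgebra_Int:
  fixes C :: "('e::banach_lattice \<Rightarrow>\<^sub>L 'e) set"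
  assumes dc: "dedekind_complete TYPE('e)" and C: "closed_op_subalgebra C"
  shows "closed_regular_subalgebra (C \<inter> regular_ops)"
  unfolding closed_regular_subalgebra_def
proof (intro conjI allI impI)
  show "op_subalgebra (C \<inter> regular_ops)"
    using C op_subalgebra_regular_ops[where 'a = 'e]
    unfolding closed_op_subalgebra_def op_subalgebra_def subspace_def by simp
  fix T S
  assume *: "(\<forall>n. T n \<in> C \<inter> regular_ops) \<and> S \<in> regular_ops \<and> (\<lambda>n. regular_norm (T n - S)) \<longlonglongrightarrow> 0"
  have "norm (T n - S) \<le> regular_norm (T n - S)" for n
    using * by (intro norm_le_regular_norm dc regular_ops_diff) auto
  then have "\<forall>\<^sub>F n in sequentially. norm (T n - S) \<le> regular_norm (T n - S)"
    by (intro always_eventually allI)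
  moreover have "(\<lambda>n. regular_norm (T n - S)) \<longlonglongrightarrow> 0" using * by simp
  ultimately have "(\<lambda>n. T n - S) \<longlonglongrightarrow> 0" by (rule Lim_null_comparison)
  then have "T \<longlonglongrightarrow> S" by (rule LIM_zero_cancel)
  then have "S \<in> C"
    using C * unfolding closed_op_subalgebra_def closed_sequential_limits by blast
  then show "S \<in> C \<inter> regular_ops" using * by simp
qed simp

section \<open>Extension property, norms, weak limits and generated subalgebras\<close>

context positive_spectral
begin

text \<open>The sets may overlap and repeat. Independence of the chosen expression is automatic,
  because the integral depends on the function alone.\<close>

lemma spectral_integral_sum:
  assumes "\<forall>i<n. \<Delta> i \<in> \<Omega>"
  shows "(\<lambda>\<xi>. \<Sum>i<n. \<alpha> i * indicator (\<Delta> i) \<xi>) \<in> bounded_measurable X \<Omega> \<and>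
    spectral_integral (\<lambda>\<xi>. \<Sum>i<(n::nat). \<alpha> i * indicator (\<Delta> i) \<xi>) = (\<Sum>i<n. \<alpha> i *\<^sub>R P (\<Delta> i))"
  using assms
proof (induction n)
  case 0
  have "(\<lambda>\<xi>. 0 * indicator {} \<xi>) \<in> bounded_measurable X \<Omega>"
    by (intro bounded_measurable_scale indicator_bounded_measurable) simp
  with spectral_integral_scale[OF indicator_bounded_measurable, of "{}" 0]
  show ?case by simp
next
  case (Suc n)
  then have "\<Delta> n \<in> \<Omega>" by simp
  note ind = indicator_bounded_measurable[OF this] spectral_integral_indicator[OF this]
  with Suc show ?case
    by (simp add: bounded_measurable_add bounded_measurable_scale spectral_integral_add spectral_integral_scale)
qed

lemma spectral_extension_spectral_integral: "spectral_extension X \<Omega> P spectral_integral"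
proof -
  have "norm (spectral_integral f) \<le> norm (P X) * sup_norm f" if "f \<in> bounded_measurable X \<Omega>" for f
    using spectral_integral_norm_le[OF that bounded_measurable_le_sup_norm[OF that]]
    by (simp add: mult.commute)
  then show ?thesis
    unfolding spectral_extension_def linear_on_functions_def bounded_on_functions_def
    using spectral_integral_sum spectral_integral_add spectral_integral_scale by blast
qed

lemma spectral_extension_unique:
  assumes \<rho>: "spectral_extension X \<Omega> P \<rho>" and f: "f \<in> bounded_measurable X \<Omega>"
  shows "\<rho> f = spectral_integral f"
proof -
  have rho_add: "\<rho> (\<lambda>\<xi>. f \<xi> + g \<xi>) = \<rho> f + \<rho> g"
    if "f \<in> bounded_measurable X \<Omega>" "g \<in> bounded_measurable X \<Omega>" for f g
    using \<rho> that by (simp add: spectral_extension_def linear_on_functions_def)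
  have rho_scale: "\<rho> (\<lambda>\<xi>. c * f \<xi>) = c *\<^sub>R \<rho> f" if "f \<in> bounded_measurable X \<Omega>" for c f
    using \<rho> that by (simp add: spectral_extension_def linear_on_functions_def)
  obtain K where K: "\<And>f. f \<in> bounded_measurable X \<Omega> \<Longrightarrow> norm (\<rho> f) \<le> K * sup_norm f"
    using \<rho> unfolding spectral_extension_def bounded_on_functions_def by blast
  from f show ?thesis
  proof (induction rule: bounded_measurable_induct)
    case (indicator A)
    \<comment> \<open>An indicator is the linear combination with \<open>n = 1\<close> and
      coefficient 1.\<close>
    have "\<forall>(n::nat) \<alpha> \<Delta>. (\<forall>i<n. \<Delta> i \<in> \<Omega>) \<longrightarrow>
        \<rho> (\<lambda>\<xi>. \<Sum>i<n. \<alpha> i * indicator (\<Delta> i) \<xi>) = (\<Sum>i<n. \<alpha> i *\<^sub>R P (\<Delta> i))"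
      using \<rho> by (simp add: spectral_extension_def)
    from this[rule_format, of 1 "\<lambda>_. A" "\<lambda>_. 1"] indicator show ?case
      by (simp add: spectral_integral_indicator)
  next
    case (add f g)
    then show ?case by (simp add: rho_add spectral_integral_add)
  next
    case (scale c f)
    then show ?case by (simp add: rho_scale spectral_integral_scale)
  next
    case (limit f s)
    have "\<forall>\<^sub>F n in sequentially. norm (\<rho> (s n) - \<rho> f) \<le> \<bar>K\<bar> * (1 / real (Suc n))"
    proof (rule always_eventually, rule allI)
      fix n
      \<comment> \<open>The difference is spelled as a sum with a scalar multiple, the form in which
        linearity of \<rho> is given.\<close>
      have bm: "(\<lambda>\<xi>. s n \<xi> + - 1 * f \<xi>) \<in> bounded_measurable X \<Omega>"
        by (intro bounded_measurable_add bounded_measurable_scale limit)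
      have "\<rho> (s n) - \<rho> f = \<rho> (\<lambda>\<xi>. s n \<xi> + - 1 * f \<xi>)"
        using limit by (simp only: rho_add rho_scale bounded_measurable_scale) simp
      also have "norm \<dots> \<le> K * sup_norm (\<lambda>\<xi>. s n \<xi> + - 1 * f \<xi>)"
        by (rule K[OF bm])
      \<comment> \<open>The bound \<open>K\<close> comes without a sign; its absolute value allows
        multiplying the next inequality.\<close>
      also have "\<dots> \<le> \<bar>K\<bar> * sup_norm (\<lambda>\<xi>. s n \<xi> + - 1 * f \<xi>)"
        using bounded_measurable_le_sup_norm[OF bm] by (intro mult_right_mono) (auto intro: order.trans[OF abs_ge_zero])
      also have "\<dots> \<le> \<bar>K\<bar> * (1 / real (Suc n))"
        using limit.hyps(3)[of n] by (intro mult_left_mono sup_norm_le) simp_all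
      finally show "norm (\<rho> (s n) - \<rho> f) \<le> \<bar>K\<bar> * (1 / real (Suc n))" .
    qed
    moreover have "(\<lambda>n. \<bar>K\<bar> * (1 / real (Suc n))) \<longlonglongrightarrow> 0"
      by (rule tendsto_mult_right_zero) (use LIMSEQ_inverse_real_of_nat in \<open>simp only: inverse_eq_divide\<close>)
    ultimately have "(\<lambda>n. \<rho> (s n) - \<rho> f) \<longlonglongrightarrow> 0" by (rule Lim_null_comparison)
    then have "(\<lambda>n. \<rho> (s n)) \<longlonglongrightarrow> \<rho> f" by (rule LIM_zero_cancel)
    moreover have "(\<lambda>n. \<rho> (s n)) \<longlonglongrightarrow> spectral_integral f"
      unfolding limit.IH by (rule spectral_integral_limit) (fact limit)+
    ultimately show ?case by (rule LIMSEQ_unique)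
  qed
qed

lemma positive_representation_spectral_integral:
  "positive_representation (bounded_measurable X \<Omega>) spectral_integral"
  unfolding positive_representation_def linear_on_functions_def
  by (simp add: spectral_integral_add spectral_integral_scale spectral_integral_mult spectral_integral_positive)

text \<open>The supremum is attained at \<open>indicator X\<close>. A general \<open>N\<close>
  covers both the operator norm and the regular norm, which agree at the positive operator
  \<open>P X\<close>.\<close>

lemma map_norm_spectral_integral:
  assumes le: "\<And>f. f \<in> bounded_measurable X \<Omega> \<Longrightarrow> N (spectral_integral f) \<le> sup_norm f * norm (P X)"
    and eq: "N (P X) = norm (P X)"
  shows "map_norm (bounded_measurable X \<Omega>) N spectral_integral = norm (P X)"
  unfolding map_norm_def
proof (rule cSup_eq_maximum)
  have "sup_norm (indicator X) \<le> 1"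
    by (rule sup_norm_le) (simp add: indicator_def)
  then have "indicator X \<in> {f \<in> bounded_measurable X \<Omega>. sup_norm f \<le> 1}"
    by (simp add: indicator_bounded_measurable)
  moreover have "norm (P X) = N (spectral_integral (indicator X))"
    by (simp add: eq spectral_integral_indicator)
  ultimately show "norm (P X) \<in> (\<lambda>f. N (spectral_integral f)) ` {f \<in> bounded_measurable X \<Omega>. sup_norm f \<le> 1}"
    by (intro image_eqI[of _ _ "indicator X"])
next
  fix r assume "r \<in> (\<lambda>f. N (spectral_integral f)) ` {f \<in> bounded_measurable X \<Omega>. sup_norm f \<le> 1}"
  then obtain f where f: "f \<in> bounded_measurable X \<Omega>" "sup_norm f \<le> 1" "r = N (spectral_integral f)"
    by blast
  have "r \<le> sup_norm f * norm (P X)" using le[OF f(1)] f(3) by simp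
  also have "\<dots> \<le> 1 * norm (P X)" by (intro mult_right_mono f(2) norm_ge_zero)
  finally show "r \<le> norm (P X)" by simp
qed

lemma spectral_integral_weak_limit:
  assumes f: "f \<in> bounded_measurable X \<Omega>" and s: "\<And>n. s n \<in> bounded_measurable X \<Omega>"
    and K: "\<And>n. sup_norm (s n) \<le> K" and lim: "\<And>\<xi>. \<xi> \<in> X \<Longrightarrow> (\<lambda>n. s n \<xi>) \<longlonglongrightarrow> f \<xi>"
  shows "limitin weak_operator_topology (\<lambda>n. spectral_integral (s n)) (spectral_integral f) sequentially"
proof (rule limitin_weak_operator_topology)
  fix x and x' :: "'e \<Rightarrow>\<^sub>L real"
  have "\<bar>s n \<xi>\<bar> \<le> K" for n \<xi>
    using bounded_measurable_le_sup_norm[OF s] K by (rule order.trans)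
  from bounded_signed_measure.signed_integral_dominated_convergence[OF scalar_measure f s lim this]
  show "(\<lambda>n. blinfun_apply x' (blinfun_apply (spectral_integral (s n)) x)) \<longlonglongrightarrow>
      blinfun_apply x' (blinfun_apply (spectral_integral f) x)"
    using represents_spectral_integral[OF f] represents_spectral_integral[OF s]
    unfolding represents_def by simp
qed

lemma P_subset_simple: "P ` \<Omega> \<subseteq> spectral_integral ` simple_functions X \<Omega>"
  using spectral_integral_indicator indicator_simple by (metis image_subsetI image_eqI)

lemma spectral_integral_simple_subset:
  "spectral_integral ` simple_functions X \<Omega> \<subseteq> spectral_integral ` bounded_measurable X \<Omega>"
  by (intro image_mono simple_subset_bounded_measurable)

text \<open>Closedness is left abstract so that the operator norm and the regular norm share one
  induction.\<close>

lemma spectral_integral_in_closed_subspace: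
  assumes C: "subspace C" and P: "P ` \<Omega> \<subseteq> C"
    and closed: "\<And>f s. f \<in> bounded_measurable X \<Omega> \<Longrightarrow> (\<And>n. s n \<in> bounded_measurable X \<Omega>) \<Longrightarrow>
      (\<And>n. spectral_integral (s n) \<in> C) \<Longrightarrow> (\<And>n \<xi>. \<bar>s n \<xi> - f \<xi>\<bar> \<le> 1 / real (Suc n)) \<Longrightarrow>
      spectral_integral f \<in> C"
  shows "spectral_integral ` bounded_measurable X \<Omega> \<subseteq> C"
proof (rule image_subsetI)
  fix f assume "f \<in> bounded_measurable X \<Omega>"
  then show "spectral_integral f \<in> C"
  proof (induction rule: bounded_measurable_induct)
    case (indicator A)
    then show ?case using P by (auto simp: spectral_integral_indicator)
  next
    case (add f g)
    then show ?case using C by (simp add: spectral_integral_add subspace_add)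
  next
    case (scale c f)
    then show ?case using C by (simp add: spectral_integral_scale subspace_scale)
  next
    case (limit f s)
    show ?case by (rule closed) (fact limit)+
  qed
qed

lemma spectral_integral_in_closed_op_subalgebra:
  assumes C: "closed_op_subalgebra C" and P: "P ` \<Omega> \<subseteq> C"
  shows "spectral_integral ` bounded_measurable X \<Omega> \<subseteq> C"
proof (rule spectral_integral_in_closed_subspace[OF _ P])
  show "subspace C" using C by (simp add: closed_op_subalgebra_def op_subalgebra_def)
  have "closed C" using C by (simp add: closed_op_subalgebra_def)
  fix f s
  assume f: "f \<in> bounded_measurable X \<Omega>" and s: "\<And>n. s n \<in> bounded_measurable X \<Omega>"
    and sC: "\<And>n. spectral_integral (s n) \<in> C" and close: "\<And>n \<xi>. \<bar>s n \<xi> - f \<xi>\<bar> \<le> 1 / real (Suc n)"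
  show "spectral_integral f \<in> C"
    by (rule closed_sequentially[OF \<open>closed C\<close> sC spectral_integral_limit[OF f s close]])
qed

text \<open>The order bound turns uniform approximation into convergence in the regular norm, and
  the limit operator is itself regular, as closedness in that norm demands.\<close>

lemma spectral_integral_in_closed_regular_subalgebra:
  assumes dc: "dedekind_complete TYPE('e)"
    and C: "closed_regular_subalgebra C" and P: "P ` \<Omega> \<subseteq> C"
  shows "spectral_integral ` bounded_measurable X \<Omega> \<subseteq> C"
proof (rule spectral_integral_in_closed_subspace[OF _ P])
  show "subspace C" using C by (simp add: closed_regular_subalgebra_def op_subalgebra_def)
  fix f s
  assume f: "f \<in> bounded_measurable X \<Omega>" and s: "\<And>n. s n \<in> bounded_measurable X \<Omega>"
    and sC: "\<And>n. spectral_integral (s n) \<in> C" and close: "\<And>n \<xi>. \<bar>s n \<xi> - f \<xi>\<bar> \<le> 1 / real (Suc n)"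
  have "regular_norm (spectral_integral (s n) - spectral_integral f) \<le> 1 / real (Suc n) * norm (P X)" for n
    unfolding spectral_integral_diff[OF s f, symmetric]
    by (intro spectral_integral_regular_norm_le dc bounded_measurable_diff s f close)
  moreover have "0 \<le> regular_norm (spectral_integral (s n) - spectral_integral f)" for n
    by (simp add: regular_norm_def)
  ultimately have "(\<lambda>n. regular_norm (spectral_integral (s n) - spectral_integral f)) \<longlonglongrightarrow> 0"
    by (intro Lim_null_comparison[OF _ null_sequence_norm_P] always_eventually allI) simp
  moreover have "\<forall>T S. (\<forall>n::nat. T n \<in> C) \<and> S \<in> regular_ops \<and>
      (\<lambda>n. regular_norm (T n - S)) \<longlonglongrightarrow> 0 \<longrightarrow> S \<in> C"
    using C unfolding closed_regular_subalgebra_def by (elim conjE)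
  from this[rule_format, of "\<lambda>n. spectral_integral (s n)" "spectral_integral f"]
  have "(\<lambda>n. regular_norm (spectral_integral (s n) - spectral_integral f)) \<longlonglongrightarrow> 0 \<Longrightarrow> spectral_integral f \<in> C"
    using sC spectral_integral_regular[OF f] by simp
  ultimately show "spectral_integral f \<in> C" by simp
qed

end

theorem theorem4p1:
  fixes X :: "'a set" and \<Omega> :: "'a set set"
    and P :: "'a set \<Rightarrow> 'e::banach_lattice \<Rightarrow>\<^sub>L 'e"
  assumes "sigma_algebra X \<Omega>"
    and "positive_spectral_measure \<Omega> P"
  shows "\<exists>\<pi> :: ('a \<Rightarrow> real) \<Rightarrow> 'e \<Rightarrow>\<^sub>L 'e.
    \<comment> \<open>(1)\<close>
    spectral_extension X \<Omega> P \<pi> \<and>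
    (\<forall>\<rho>. spectral_extension X \<Omega> P \<rho> \<longrightarrow> (\<forall>\<phi>\<in>bounded_measurable X \<Omega>. \<rho> \<phi> = \<pi> \<phi>)) \<and>
    positive_representation (bounded_measurable X \<Omega>) \<pi> \<and>
    \<pi> ` bounded_measurable X \<Omega> \<subseteq> regular_ops \<and>
    map_norm (bounded_measurable X \<Omega>) norm \<pi> = norm (P X) \<and>
    norm (P X) = norm (\<pi> (indicator X)) \<and>
    \<comment> \<open>(2)\<close>
    (\<pi> (indicator X) = id_blinfun \<longleftrightarrow> P X = id_blinfun) \<and>
    \<comment> \<open>(3)\<close>
    (\<forall>\<phi>\<in>bounded_measurable X \<Omega>.
       \<pi> \<phi> \<in> regular_ops \<and>
       (\<forall>T :: 'e \<Rightarrow>\<^sub>L 'e.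
          (\<forall>x x'. blinfun_apply x' (blinfun_apply T x) =
                    signed_integral X \<Omega> (spectral_scalar_measure P x x') \<phi>)
          \<longleftrightarrow> T = \<pi> \<phi>)) \<and>
    \<comment> \<open>(4)\<close>
    (\<forall>\<phi>\<in>bounded_measurable X \<Omega>. \<forall>\<phi>s :: nat \<Rightarrow> 'a \<Rightarrow> real.
       (\<forall>n. \<phi>s n \<in> bounded_measurable X \<Omega>) \<and>
       (\<exists>K. \<forall>n. sup_norm (\<phi>s n) \<le> K) \<and>
       (\<forall>\<xi>\<in>X. (\<lambda>n. \<phi>s n \<xi>) \<longlonglongrightarrow> \<phi> \<xi>) \<longrightarrow>
       limitin weak_operator_topology (\<lambda>n. \<pi> (\<phi>s n)) (\<pi> \<phi>) sequentially) \<and>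
    \<comment> \<open>(5)\<close>
    closed_op_subalgebra hull (P ` \<Omega>) = closed_op_subalgebra hull (\<pi> ` simple_functions X \<Omega>) \<and>
    closed_op_subalgebra hull (\<pi> ` simple_functions X \<Omega>) =
      closed_op_subalgebra hull (\<pi> ` bounded_measurable X \<Omega>) \<and>
    \<comment> \<open>(6)\<close>
    commutant (P ` \<Omega>) = commutant (\<pi> ` simple_functions X \<Omega>) \<and>
    commutant (\<pi> ` simple_functions X \<Omega>) = commutant (\<pi> ` bounded_measurable X \<Omega>) \<and>
    \<comment> \<open>(7)\<close>
    (dedekind_complete TYPE('e) \<longrightarrow>
       bounded_on_functions (bounded_measurable X \<Omega>) regular_norm \<pi> \<and>
       map_norm (bounded_measurable X \<Omega>) regular_norm \<pi> = norm (P X) \<and>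
       norm (P X) = norm (\<pi> (indicator X)) \<and>
       closed_regular_subalgebra hull (P ` \<Omega>) =
         closed_regular_subalgebra hull (\<pi> ` simple_functions X \<Omega>) \<and>
       closed_regular_subalgebra hull (\<pi> ` simple_functions X \<Omega>) =
         closed_regular_subalgebra hull (\<pi> ` bounded_measurable X \<Omega>) \<and>
       closed_regular_subalgebra hull (P ` \<Omega>) \<subseteq> closed_op_subalgebra hull (P ` \<Omega>))"
proof -
  interpret positive_spectral X \<Omega> P
    by (intro positive_spectral.intro assms) (unfold_locales, rule assms)
  let ?B = "bounded_measurable X \<Omega>" and ?S = "simple_functions X \<Omega>"
  have iX: "spectral_integral (indicator X) = P X" by (simp add: spectral_integral_indicator)
  have norm_le: "norm (spectral_integral f) \<le> sup_norm f * norm (P X)" if "f \<in> ?B" for f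
    by (rule spectral_integral_norm_le[OF that bounded_measurable_le_sup_norm[OF that]])
  \<comment> \<open>The three sets increase, and a closed subalgebra above the smallest already
    contains the largest. This serves the generated subalgebras and the commutants alike.\<close>
  have op_subset: "P ` \<Omega> \<subseteq> C \<longleftrightarrow> spectral_integral ` ?S \<subseteq> C"
    "spectral_integral ` ?S \<subseteq> C \<longleftrightarrow> spectral_integral ` ?B \<subseteq> C"
    if "closed_op_subalgebra C" for C
    using spectral_integral_in_closed_op_subalgebra[OF that]
      P_subset_simple spectral_integral_simple_subset by (meson order.trans)+
  show ?thesis
  proof (intro exI[of _ spectral_integral] conjI ballI allI impI)
    show "spectral_extension X \<Omega> P spectral_integral"
      by (rule spectral_extension_spectral_integral)
    show "\<rho> \<phi> = spectral_integral \<phi>" if "spectral_extension X \<Omega> P \<rho>" "\<phi> \<in> ?B" for \<rho> \<phi>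
      by (rule spectral_extension_unique[OF that])
    show "positive_representation ?B spectral_integral"
      by (rule positive_representation_spectral_integral)
    show "spectral_integral ` ?B \<subseteq> regular_ops"
      using spectral_integral_regular by blast
    show "map_norm ?B norm spectral_integral = norm (P X)"
      by (rule map_norm_spectral_integral[OF norm_le refl])
    show "norm (P X) = norm (spectral_integral (indicator X))" by (simp add: iX)
    then show "norm (P X) = norm (spectral_integral (indicator X))" .
    show "(spectral_integral (indicator X) = id_blinfun) = (P X = id_blinfun)" by (simp add: iX)
    show "spectral_integral \<phi> \<in> regular_ops" if "\<phi> \<in> ?B" for \<phi>
      by (rule spectral_integral_regular[OF that])
    show "(\<forall>x x'. blinfun_apply x' (blinfun_apply T x) =
        signed_integral X \<Omega> (spectral_scalar_measure P x x') \<phi>) \<longleftrightarrow> T = spectral_integral \<phi>"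
      if "\<phi> \<in> ?B" for \<phi> T
      unfolding represents_def[symmetric]
      using represents_spectral_integral[OF that] represents_unique by blast
    show "limitin weak_operator_topology (\<lambda>n. spectral_integral (\<phi>s n)) (spectral_integral \<phi>) sequentially"
      if "\<phi> \<in> ?B" "(\<forall>n. \<phi>s n \<in> ?B) \<and> (\<exists>K. \<forall>n. sup_norm (\<phi>s n) \<le> K) \<and>
        (\<forall>\<xi>\<in>X. (\<lambda>n. \<phi>s n \<xi>) \<longlonglongrightarrow> \<phi> \<xi>)" for \<phi> \<phi>s
      using that by (auto intro: spectral_integral_weak_limit)
    show "closed_op_subalgebra hull (P ` \<Omega>) = closed_op_subalgebra hull (spectral_integral ` ?S)"
      by (intro hull_eqI op_subset)
    show "closed_op_subalgebra hull (spectral_integral ` ?S) = closed_op_subalgebra hull (spectral_integral ` ?B)"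
      by (intro hull_eqI op_subset)
    show "commutant (P ` \<Omega>) = commutant (spectral_integral ` ?S)"
      by (intro commutant_eqI op_subset)
    show "commutant (spectral_integral ` ?S) = commutant (spectral_integral ` ?B)"
      by (intro commutant_eqI op_subset)
  next
    assume dc: "dedekind_complete TYPE('e)"
    have rnorm_le: "regular_norm (spectral_integral f) \<le> sup_norm f * norm (P X)" if "f \<in> ?B" for f
      by (rule spectral_integral_regular_norm_le[OF dc that bounded_measurable_le_sup_norm[OF that]])
    show "bounded_on_functions ?B regular_norm spectral_integral"
      unfolding bounded_on_functions_def
    proof (intro exI ballI)
      show "regular_norm (spectral_integral f) \<le> norm (P X) * sup_norm f" if "f \<in> ?B" for f
        using rnorm_le[OF that] by (simp only: mult.commute)
    qed
    show "map_norm ?B regular_norm spectral_integral = norm (P X)"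
      by (rule map_norm_spectral_integral[OF rnorm_le]) (simp_all add: regular_norm_positive_op P_positive)
    have reg_subset: "P ` \<Omega> \<subseteq> C \<longleftrightarrow> spectral_integral ` ?S \<subseteq> C"
      "spectral_integral ` ?S \<subseteq> C \<longleftrightarrow> spectral_integral ` ?B \<subseteq> C"
      if "closed_regular_subalgebra C" for C
      using spectral_integral_in_closed_regular_subalgebra[OF dc that]
        P_subset_simple spectral_integral_simple_subset by (meson order.trans)+
    show "closed_regular_subalgebra hull (P ` \<Omega>) = closed_regular_subalgebra hull (spectral_integral ` ?S)"
      by (intro hull_eqI reg_subset)
    show "closed_regular_subalgebra hull (spectral_integral ` ?S) = closed_regular_subalgebra hull (spectral_integral ` ?B)"
      by (intro hull_eqI reg_subset)
    \<comment> \<open>Any competitor \<open>C\<close> for the larger hull, cut down to the regular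
      operators, is a competitor for the smaller one.\<close>
    have "closed_regular_subalgebra hull (P ` \<Omega>) \<subseteq> C" if "closed_op_subalgebra C" "P ` \<Omega> \<subseteq> C" for C
    proof -
      have "P ` \<Omega> \<subseteq> C \<inter> regular_ops"
        using that(2) by (auto intro: positive_op_regular P_positive)
      from hull_minimal[of _ _ closed_regular_subalgebra, OF this closed_regular_subalgebra_Int[OF dc that(1)]]
      show ?thesis by blast
    qed
    then show "closed_regular_subalgebra hull (P ` \<Omega>) \<subseteq> closed_op_subalgebra hull (P ` \<Omega>)"
      unfolding hull_def[of closed_op_subalgebra] by blast
  qed
qed

end
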